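(* Let $ABC$ be the excentral triangle of a triangle $H_1H_2H_3$, so that $H_1,H_2,H_3$ are the feet of the altitudes of $ABC$ and $H_1H_2H_3$ is the orthic triangle of $ABC$. Let $\mathcal{K}$ be the Thomson cubic of the triangle $H_1H_2H_3$. Then $\mathcal{K}$ passes through the following points: the vertices $A,B,C$; the feet of the altitudes $H_1,H_2,H_3$ of $ABC$; the midpoints of the sides of the orthic triangle $H_1H_2H_3$; the orthocenter of $ABC$; the Euler point (nine-point center) of $ABC$; the centroid of the orthic triangle $H_1H_2H_3$; the Lemoine (symmedian) point of $ABC$; and the homothetic center of the orthic triangle and the tangential triangle of $ABC$.
   Context: The Thomson cubic of a triangle is the cubic curve passing through its vertices, the midpoints of its sides, its excenters, incenter, centroid, circumcenter, Lemoine point, mittenpunkt, and the isogonal conjugate of its mittenpunkt (it is the locus of points $P$ such that $P$, its isogonal conjugate, and the centroid are collinear). The mittenpunkt of a triangle is the Lemoine point of its excentral triangle. The excentral triangle of a triangle has as vertices its three excenters. The tangential triangle of $ABC$ is formed by the tangents to the circumcircle of $ABC$ at $A,B,C$; it is homothetic to the orthic triangle. *)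

theory Defs
  imports "HOL-Analysis.Analysis"
begin

type_synonym point = "real^2"

definition perp_foot :: "point \<Rightarrow> point \<Rightarrow> point \<Rightarrow> point" where
  "perp_foot P X Y = (THE F. F \<in> affine hull {X, Y} \<and> orthogonal (P - F) (Y - X))"

definition line_reflection :: "point \<Rightarrow> point \<Rightarrow> point \<Rightarrow> point" where
  "line_reflection X Y P = 2 *\<^sub>R perp_foot P X Y - P"

text \<open>
  Bisectors of the angle \<open>X V Y\<close>: the sum and the difference of the unit vectors along the two
  sides are direction vectors of the internal and of the external bisector.
\<close>

definition internal_bisector :: "point \<Rightarrow> point \<Rightarrow> point \<Rightarrow> point set" where
  "internal_bisector V X Y = affine hull {V, V + (sgn (X - V) + sgn (Y - V))}"

definition external_bisector :: "point \<Rightarrow> point \<Rightarrow> point \<Rightarrow> point set" where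
  "external_bisector V X Y = affine hull {V, V + (sgn (X - V) - sgn (Y - V))}"

definition incenter :: "point \<Rightarrow> point \<Rightarrow> point \<Rightarrow> point" where
  "incenter A B C = (THE P. P \<in> internal_bisector A B C \<and>
     P \<in> internal_bisector B C A \<and> P \<in> internal_bisector C A B)"

text \<open>The excenter opposite to the vertex given as first argument.\<close>

definition excenter :: "point \<Rightarrow> point \<Rightarrow> point \<Rightarrow> point" where
  "excenter A B C = (THE P. P \<in> internal_bisector A B C \<and>
     P \<in> external_bisector B C A \<and> P \<in> external_bisector C A B)"

definition excentral_triangle :: "point \<Rightarrow> point \<Rightarrow> point \<Rightarrow> point \<times> point \<times> point" where
  "excentral_triangle A B C = (excenter A B C, excenter B C A, excenter C A B)"

definition centroid :: "point \<Rightarrow> point \<Rightarrow> point \<Rightarrow> point" where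
  "centroid A B C = (1/3) *\<^sub>R (A + B + C)"

definition circumcenter :: "point \<Rightarrow> point \<Rightarrow> point \<Rightarrow> point" where
  "circumcenter A B C = (THE P. dist P A = dist P B \<and> dist P B = dist P C)"

definition orthocenter :: "point \<Rightarrow> point \<Rightarrow> point \<Rightarrow> point" where
  "orthocenter A B C = (THE P. orthogonal (P - A) (C - B) \<and>
     orthogonal (P - B) (A - C) \<and> orthogonal (P - C) (B - A))"

definition orthic_triangle :: "point \<Rightarrow> point \<Rightarrow> point \<Rightarrow> point \<times> point \<times> point" where
  "orthic_triangle A B C = (perp_foot A B C, perp_foot B C A, perp_foot C A B)"

definition nine_point_center :: "point \<Rightarrow> point \<Rightarrow> point \<Rightarrow> point" where
  "nine_point_center A B C = circumcenter (midpoint B C) (midpoint C A) (midpoint A B)"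

text \<open>
  The line \<open>V P\<close> reflected in the internal bisector of the angle \<open>X V Y\<close>, for \<open>P \<noteq> V\<close>.
  The isogonal conjugate is used below only for points off the side lines and off the circumcircle,
  where the three reflected lines do have exactly one common point.
\<close>

definition isogonal_line :: "point \<Rightarrow> point \<Rightarrow> point \<Rightarrow> point \<Rightarrow> point set" where
  "isogonal_line V X Y P =
     line_reflection V (V + (sgn (X - V) + sgn (Y - V))) ` (affine hull {V, P})"

definition isogonal_conjugate :: "point \<Rightarrow> point \<Rightarrow> point \<Rightarrow> point \<Rightarrow> point" where
  "isogonal_conjugate A B C P = (THE Q. Q \<in> isogonal_line A B C P \<and>
     Q \<in> isogonal_line B C A P \<and> Q \<in> isogonal_line C A B P)"

text \<open>The common point of the symmedians, i.e. of the medians reflected in the bisectors.\<close>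

definition lemoine_point :: "point \<Rightarrow> point \<Rightarrow> point \<Rightarrow> point" where
  "lemoine_point A B C = isogonal_conjugate A B C (centroid A B C)"

definition mittenpunkt :: "point \<Rightarrow> point \<Rightarrow> point \<Rightarrow> point" where
  "mittenpunkt A B C = (case excentral_triangle A B C of (X, Y, Z) \<Rightarrow> lemoine_point X Y Z)"

text \<open>The tangent at \<open>A\<close> to the circumcircle of \<open>A B C\<close>.\<close>

definition circum_tangent :: "point \<Rightarrow> point \<Rightarrow> point \<Rightarrow> point set" where
  "circum_tangent A B C = {P. orthogonal (P - A) (A - circumcenter A B C)}"

definition tangential_vertex :: "point \<Rightarrow> point \<Rightarrow> point \<Rightarrow> point" where
  "tangential_vertex A B C = (THE P. P \<in> circum_tangent B C A \<and> P \<in> circum_tangent C A B)"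

definition tangential_triangle :: "point \<Rightarrow> point \<Rightarrow> point \<Rightarrow> point \<times> point \<times> point" where
  "tangential_triangle A B C =
     (tangential_vertex A B C, tangential_vertex B C A, tangential_vertex C A B)"

text \<open>The center of the homothety taking the first triangle to the second, vertex by vertex.\<close>

fun homothetic_center :: "point \<times> point \<times> point \<Rightarrow> point \<times> point \<times> point \<Rightarrow> point" where
  "homothetic_center (X1, X2, X3) (Y1, Y2, Y3) = (THE S. \<exists>k. k \<noteq> 0 \<and>
     Y1 = S + k *\<^sub>R (X1 - S) \<and> Y2 = S + k *\<^sub>R (X2 - S) \<and> Y3 = S + k *\<^sub>R (X3 - S))"

text \<open>Real affine points of plane curves of degree exactly 3, possibly reducible.\<close>

definition cubic_curve :: "point set \<Rightarrow> bool" where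
  "cubic_curve K \<longleftrightarrow> (\<exists>c :: nat \<Rightarrow> nat \<Rightarrow> real. (\<exists>i\<le>3. c i (3 - i) \<noteq> 0) \<and>
     K = {P. (\<Sum>i\<le>3. \<Sum>j\<le>3 - i. c i j * (P $ 1) ^ i * (P $ 2) ^ j) = 0})"

text \<open>
  For every non-degenerate triangle exactly one cubic passes through these points. Already the
  vertices, the incenter, the excenters and two of the midpoints determine the equation up to a
  factor: the vertices, the incenter and the excenters leave the cubics
  \<open>u x (c\<^sup>2 y\<^sup>2 - b\<^sup>2 z\<^sup>2) + v y (a\<^sup>2 z\<^sup>2 - c\<^sup>2 x\<^sup>2) + w z (b\<^sup>2 x\<^sup>2 - a\<^sup>2 y\<^sup>2) = 0\<close>
  in barycentric coordinates, and the midpoints force \<open>u = v = w\<close>. The resulting equation says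
  that \<open>P = (x : y : z)\<close>, its isogonal conjugate \<open>(a\<^sup>2 y z : b\<^sup>2 z x : c\<^sup>2 x y)\<close> and the centroid
  \<open>(1 : 1 : 1)\<close> are collinear.
\<close>

definition thomson_cubic :: "point \<Rightarrow> point \<Rightarrow> point \<Rightarrow> point set" where
  "thomson_cubic A B C = (THE K. cubic_curve K \<and>
     {A, B, C,
      midpoint B C, midpoint C A, midpoint A B,
      excenter A B C, excenter B C A, excenter C A B,
      incenter A B C, centroid A B C, circumcenter A B C, lemoine_point A B C,
      mittenpunkt A B C, isogonal_conjugate A B C (mittenpunkt A B C)} \<subseteq> K)"

end

theory Submission
  imports Defs
begin

text \<open>
  Every listed point is one of the points that define the Thomson cubic of \<open>H1 H2 H3\<close>: the altitudes
  of the excentral triangle are the internal bisectors of \<open>H1 H2 H3\<close>, so its orthocenter is the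
  incenter; the circumcircle of \<open>H1 H2 H3\<close> is its nine-point circle; its Lemoine point is the
  mittenpunkt by definition; and, with \<open>u = b + c - a\<close>, \<open>v = c + a - b\<close>, \<open>w = a + b - c\<close>, the
  homothetic center is \<open>(a v w : b w u : c u v)\<close>, the isogonal conjugate of the mittenpunkt
  \<open>(a u : b v : c w)\<close>. It remains to see that a unique cubic passes through the defining points.
  The vertices, the midpoints and the in- and excenters determine a ternary cubic form up to a factor;
  that the resulting equation has degree exactly 3 is seen from its third difference along a side.
\<close>

section \<open>Barycentric coordinates\<close>

text \<open>All computations use barycentric coordinates of \<open>H1 H2 H3\<close> rather than of
  the excentral triangle: the points involved then have coordinates polynomial in \<open>a\<close>,
  \<open>b\<close>, \<open>c\<close>, whereas the sides of the excentral triangle involve square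
  roots. Two obstacles shape the rest. First, every center and the cubic itself are definite
  descriptions, so nothing can be read off before existence and uniqueness are shown; the strict
  triangle inequalities keep the coordinate sums nonzero. Second, cubics are given by Cartesian
  coefficients with a condition on their cubic part, while the points live in homogeneous
  coordinates. The translation goes both ways: a Cartesian cubic is homogenized to a ternary form,
  and the Thomson form is pulled back along affine coordinate functions. Third differences carry the
  degree condition across because they do not refer to the axes; the same condition rules out a zero
  factor in the uniqueness argument.\<close>

definition comb :: "point \<Rightarrow> point \<Rightarrow> point \<Rightarrow> real \<Rightarrow> real \<Rightarrow> real \<Rightarrow> point" where
  "comb A B C x y z = x *\<^sub>R A + y *\<^sub>R B + z *\<^sub>R C"

text \<open>Homogeneous coordinates; for \<open>x + y + z = 0\<close> the value is the junk point \<open>0\<close>.\<close>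

definition bary :: "point \<Rightarrow> point \<Rightarrow> point \<Rightarrow> real \<Rightarrow> real \<Rightarrow> real \<Rightarrow> point" where
  "bary A B C x y z = comb A B C (x / (x + y + z)) (y / (x + y + z)) (z / (x + y + z))"

definition cross2 :: "point \<Rightarrow> point \<Rightarrow> real" where
  "cross2 u v = u $ 1 * v $ 2 - u $ 2 * v $ 1"

lemma point_eq_iff: "P = Q \<longleftrightarrow> P $ 1 = Q $ 1 \<and> P $ 2 = Q $ 2" for P Q :: point
  by (simp add: vec_eq_iff forall_2)

lemma cross2_eq_0_imp_parallel:
  assumes "cross2 u v = 0" "u \<noteq> 0"
  shows "\<exists>k. v = k *\<^sub>R u"
proof (cases "u $ 1 = 0")
  case True
  then have "u $ 2 \<noteq> 0"
    using assms(2) by (simp add: point_eq_iff)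
  then show ?thesis
    using True assms(1)
    by (intro exI[of _ "v $ 2 / u $ 2"]) (simp add: point_eq_iff cross2_def)
next
  case False
  then show ?thesis
    using assms(1)
    by (intro exI[of _ "v $ 1 / u $ 1"]) (simp add: point_eq_iff cross2_def field_simps)
qed

lemma collinear_iff_cross2: "collinear {A, B, C} \<longleftrightarrow> cross2 (B - A) (C - A) = 0"
proof
  assume "collinear {A, B, C}"
  then obtain u where "\<forall>x\<in>{A,B,C}. \<forall>y\<in>{A,B,C}. \<exists>k. x - y = k *\<^sub>R u"
    unfolding collinear_def by blast
  then obtain k l where "B - A = k *\<^sub>R u" "C - A = l *\<^sub>R u"
    by blast
  then show "cross2 (B - A) (C - A) = 0"
    by (simp only:) (simp add: cross2_def)
next
  assume *: "cross2 (B - A) (C - A) = 0"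
  show "collinear {A, B, C}"
  proof (cases "B = A")
    case False
    then obtain k where "C - A = k *\<^sub>R (B - A)"
      using cross2_eq_0_imp_parallel[OF *] by auto
    then have "collinear {0, B - A, C - A}"
      by (auto simp: collinear_lemma)
    then have "collinear {B, A, C}"
      by (simp add: collinear_3[of B A C])
    then show ?thesis
      by (simp add: insert_commute)
  qed auto
qed

text \<open>Cramer's rule in the basis \<open>B - A\<close>, \<open>C - A\<close>; the vector
  identity is checked after multiplication by the determinant \<open>D\<close>, where it is
  polynomial.\<close>

lemma comb_exhaust:
  assumes "\<not> collinear {A, B, C}"
  obtains x y z where "x + y + z = 1" "P = comb A B C x y z"
proof -
  define D where "D = cross2 (B - A) (C - A)"
  have "D \<noteq> 0"
    using assms by (simp add: collinear_iff_cross2 D_def)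
  define y where "y = cross2 (P - A) (C - A) / D"
  define z where "z = cross2 (B - A) (P - A) / D"
  have "D * (P - A) $ i = D * (y *\<^sub>R (B - A) + z *\<^sub>R (C - A)) $ i" if "i = 1 \<or> i = 2" for i
    using that \<open>D \<noteq> 0\<close> unfolding y_def z_def
    by (elim disjE) (simp_all add: algebra_simps, simp_all add: D_def cross2_def algebra_simps)
  then have "P - A = y *\<^sub>R (B - A) + z *\<^sub>R (C - A)"
    using \<open>D \<noteq> 0\<close> by (simp add: point_eq_iff)
  then have "P = comb A B C (1 - y - z) y z"
    by (simp add: comb_def algebra_simps)
  then show ?thesis
    by (intro that[of "1 - y - z" y z]) auto
qed

text \<open>Weights of sum 0 describe a vector independent of the origin, a combination of
  \<open>B - A\<close> and \<open>C - A\<close>. Crossing it with one side isolates the coefficient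
  of the other. Uniqueness of coordinates rests on this.\<close>

lemma comb_zero:
  assumes "\<not> collinear {A, B, C}" "x + y + z = 0" "comb A B C x y z = 0"
  shows "x = 0 \<and> y = 0 \<and> z = 0"
proof -
  have x: "x = - y - z"
    using assms(2) by simp
  have *: "y *\<^sub>R (B - A) + z *\<^sub>R (C - A) = 0"
    using assms(3) unfolding x comb_def by (simp add: algebra_simps)
  have "cross2 (y *\<^sub>R (B - A) + z *\<^sub>R (C - A)) (C - A) = y * cross2 (B - A) (C - A)"
       "cross2 (B - A) (y *\<^sub>R (B - A) + z *\<^sub>R (C - A)) = z * cross2 (B - A) (C - A)"
    by (simp_all add: cross2_def algebra_simps)
  then have "y * cross2 (B - A) (C - A) = 0" "z * cross2 (B - A) (C - A) = 0"
    unfolding * by (simp_all add: cross2_def)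
  then show ?thesis
    using assms x by (simp add: collinear_iff_cross2)
qed

lemma comb_eq_iff:
  assumes "\<not> collinear {A, B, C}" "x + y + z = x' + y' + z'"
  shows "comb A B C x y z = comb A B C x' y' z' \<longleftrightarrow> x = x' \<and> y = y' \<and> z = z'"
  using comb_zero[OF assms(1), of "x - x'" "y - y'" "z - z'"] assms(2)
  by (auto simp: comb_def algebra_simps)

text \<open>Calculations are carried out at the first vertex only; these equations bring their
  cyclic instances back to the vertex order \<open>A B C\<close>.\<close>

lemma comb_rotate: "comb B C A y z x = comb A B C x y z" "comb C A B z x y = comb A B C x y z"
  by (simp_all add: comb_def)

lemma bary_rotate: "bary B C A y z x = bary A B C x y z" "bary C A B z x y = bary A B C x y z"
  by (simp_all add: bary_def comb_rotate(1)[of B C A] comb_rotate(2)[of C A B] add.commute add.left_commute)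

lemma bary_scale: "k \<noteq> 0 \<Longrightarrow> bary A B C (k * x) (k * y) (k * z) = bary A B C x y z"
  by (simp add: bary_def flip: distrib_left)

lemma normalized_sum: "x + y + z \<noteq> 0 \<Longrightarrow> x / (x + y + z) + y / (x + y + z) + z / (x + y + z) = 1" for x y z :: real
  by (simp flip: add_divide_distrib)

text \<open>Recognizes a point by proportional coordinates. The factor \<open>k\<close> can be
  supplied as a quotient of coordinates, since \<open>k = 0\<close> would contradict the sum
  1.\<close>

lemma comb_eq_baryI:
  assumes "x + y + z = 1" "x = k * p" "y = k * q" "z = k * r"
  shows "comb A B C x y z = bary A B C p q r"
proof -
  have "k \<noteq> 0" using assms by auto
  then have "bary A B C p q r = bary A B C x y z"
    using assms(2-4) bary_scale by metis
  then show ?thesis using assms(1) by (simp add: bary_def)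
qed

text \<open>The zero sums make both vectors combinations of \<open>B - A\<close> and
  \<open>C - A\<close>, whose inner products are determined by the squared side lengths. Metric
  statements thereby become polynomial in these.\<close>

lemma inner_comb:
  assumes "p + q + r = 0" "s + t + u = 0"
  shows "comb A B C p q r \<bullet> comb A B C s t u =
    - ((dist B C)\<^sup>2 * (q * u + r * t) + (dist C A)\<^sup>2 * (r * s + p * u) + (dist A B)\<^sup>2 * (p * t + q * s)) / 2"
proof -
  have p: "p = - q - r" and s: "s = - t - u"
    using assms by simp_all
  show ?thesis
    unfolding p s comb_def dist_norm power2_norm_eq_inner
    by (simp add: inner_commute algebra_simps inner_diff_left inner_diff_right)
qed

section \<open>Lines, perpendicular feet and reflections\<close>

lemma affine_hull_ray: "affine hull {V, V + d} = {V + t *\<^sub>R d |t. True}" for V d :: point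
  unfolding affine_hull_2
proof safe
  fix u v :: real assume "u + v = 1"
  then have u: "u = 1 - v" by simp
  have "u *\<^sub>R V + v *\<^sub>R (V + d) = V + v *\<^sub>R d"
    unfolding u by (simp add: algebra_simps)
  then show "\<exists>t. u *\<^sub>R V + v *\<^sub>R (V + d) = V + t *\<^sub>R d \<and> True"
    by blast
next
  fix t show "\<exists>u v. V + t *\<^sub>R d = u *\<^sub>R V + v *\<^sub>R (V + d) \<and> u + v = 1"
    by (rule exI[of _ "1 - t"], rule exI[of _ t]) (simp add: algebra_simps)
qed

lemma perp_foot_eqI:
  assumes "X \<noteq> Y" "F \<in> affine hull {X, Y}" "orthogonal (P - F) (Y - X)"
  shows "perp_foot P X Y = F"
  unfolding perp_foot_def
proof (rule the_equality)
  fix G assume G: "G \<in> affine hull {X, Y} \<and> orthogonal (P - G) (Y - X)"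
  obtain s t where s: "F = X + s *\<^sub>R (Y - X)" and t: "G = X + t *\<^sub>R (Y - X)"
    using assms(2) G affine_hull_ray[of X "Y - X"] by auto
  have "(P - F) \<bullet> (Y - X) = 0" "(P - G) \<bullet> (Y - X) = 0"
    using assms(3) G by (simp_all add: orthogonal_def)
  then have "(G - F) \<bullet> (Y - X) = 0"
    by (simp add: inner_diff_left)
  moreover have "G - F = (t - s) *\<^sub>R (Y - X)"
    unfolding s t by (simp add: algebra_simps)
  ultimately have "(t - s) * ((Y - X) \<bullet> (Y - X)) = 0"
    by simp
  then have "t = s"
    using assms(1) by simp
  then show "G = F"
    by (simp add: s t)
qed (use assms in auto)

text \<open>Equal length makes \<open>e - f\<close> perpendicular to \<open>e + f\<close>, so the
  reflection fixes \<open>e + f\<close>, negates \<open>e - f\<close>, and hence exchanges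
  \<open>e\<close> and \<open>f\<close>. Isogonality becomes a swap of coefficients.\<close>

lemma line_reflection_swap:
  fixes e f :: point
  assumes "norm e = norm f" "e + f \<noteq> 0"
  shows "line_reflection V (V + (e + f)) (V + p *\<^sub>R e + q *\<^sub>R f) = V + q *\<^sub>R e + p *\<^sub>R f"
proof -
  have "perp_foot (V + p *\<^sub>R e + q *\<^sub>R f) V (V + (e + f)) = V + ((p + q) / 2) *\<^sub>R (e + f)"
  proof (rule perp_foot_eqI)
    have eq: "V + p *\<^sub>R e + q *\<^sub>R f - (V + ((p + q) / 2) *\<^sub>R (e + f)) = ((p - q) / 2) *\<^sub>R (e - f)"
    proof -
      have "p - (p + q) / 2 = (p - q) / 2" "q - (p + q) / 2 = - ((p - q) / 2)"
        by (simp_all add: field_simps)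
      moreover have "V + p *\<^sub>R e + q *\<^sub>R f - (V + ((p + q) / 2) *\<^sub>R (e + f)) =
          (p - (p + q) / 2) *\<^sub>R e + (q - (p + q) / 2) *\<^sub>R f"
        by (simp add: scaleR_diff_left scaleR_add_right)
      ultimately show ?thesis
        by (simp only: scaleR_minus_left scaleR_diff_right) simp
    qed
    have "(e - f) \<bullet> (e + f) = 0"
      using assms(1) by (simp add: inner_diff_left inner_diff_right inner_add_right inner_commute norm_eq)
    then show "orthogonal (V + p *\<^sub>R e + q *\<^sub>R f - (V + ((p + q) / 2) *\<^sub>R (e + f))) (V + (e + f) - V)"
      unfolding eq by (simp add: orthogonal_def)
  qed (use assms(2) in \<open>auto simp: affine_hull_ray intro: exI[of _ "(p + q) / 2"]\<close>)
  moreover have double: "2 *\<^sub>R (((p + q) / 2) *\<^sub>R (e + f)) = p *\<^sub>R e + q *\<^sub>R e + p *\<^sub>R f + q *\<^sub>R f"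
  proof -
    have "2 * ((p + q) / 2) = p + q" by simp
    then show ?thesis
      by (simp only: scaleR_scaleR scaleR_add_left scaleR_add_right add_ac)
  qed
  ultimately show ?thesis
    unfolding line_reflection_def
    by (simp only: scaleR_add_right[of 2 V] double) (simp add: scaleR_2)
qed

lemma not_collinear_rotate: "\<not> collinear {A, B, C} \<Longrightarrow> \<not> collinear {B, C, A}" for A B C :: point
  by (simp add: insert_commute)

lemma not_collinear_imp_neq: "\<not> collinear {A, B, C} \<Longrightarrow> B \<noteq> A \<and> C \<noteq> A \<and> C \<noteq> B" for A B C :: point
  by (auto simp: insert_commute)

text \<open>Equality would make \<open>B - A\<close> and \<open>A - C\<close> dependent. Strictness
  keeps coordinate sums such as \<open>b + c - a\<close> positive, so that the excenters are finite
  points.\<close>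

lemma dist_triangle_strict:
  fixes A B C :: point
  assumes "\<not> collinear {A, B, C}"
  shows "dist B C < dist C A + dist A B"
proof -
  have "dist B C \<noteq> dist B A + dist A C"
  proof
    assume "dist B C = dist B A + dist A C"
    then have "norm (B - A) *\<^sub>R (A - C) = norm (A - C) *\<^sub>R (B - A)"
      by (simp add: dist_triangle_eq)
    then have "comb A B C (norm (B - A) + norm (A - C)) (- norm (A - C)) (- norm (B - A)) = 0"
      by (simp add: comb_def algebra_simps)
    then have "norm (B - A) = 0"
      using comb_zero[OF assms, of "norm (B - A) + norm (A - C)" "- norm (A - C)" "- norm (B - A)"] by simp
    then show False
      using not_collinear_imp_neq[OF assms] by auto
  qed
  then show ?thesis
    using dist_triangle[of B C A] by (simp add: dist_commute add.commute)
qed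

section \<open>Bisectors and isogonal lines as equations in coordinates\<close>

lemma comb_ray:
  assumes "x + y + z = 1"
  shows "comb A B C x y z = A + y *\<^sub>R (B - A) + z *\<^sub>R (C - A)"
proof -
  have x: "x = 1 - y - z" using assms by simp
  show ?thesis unfolding x by (simp add: comb_def algebra_simps)
qed

lemma comb_in_ray_iff:
  assumes "\<not> collinear {A, B, C}" "x + y + z = 1"
  shows "comb A B C x y z \<in> affine hull {A, A + (p *\<^sub>R (B - A) + q *\<^sub>R (C - A))}
    \<longleftrightarrow> (\<exists>t. y = t * p \<and> z = t * q)"
proof -
  have "A + t *\<^sub>R (p *\<^sub>R (B - A) + q *\<^sub>R (C - A)) = comb A B C (1 - t * p - t * q) (t * p) (t * q)" for t
    by (simp add: comb_def algebra_simps)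
  then have "comb A B C x y z \<in> affine hull {A, A + (p *\<^sub>R (B - A) + q *\<^sub>R (C - A))} \<longleftrightarrow>
     (\<exists>t. comb A B C x y z = comb A B C (1 - t * p - t * q) (t * p) (t * q))"
    by (auto simp: affine_hull_ray)
  also have "\<dots> \<longleftrightarrow> (\<exists>t. x = 1 - t * p - t * q \<and> y = t * p \<and> z = t * q)"
    using assms by (subst comb_eq_iff) auto
  also have "\<dots> \<longleftrightarrow> (\<exists>t. y = t * p \<and> z = t * q)"
    using assms(2) by (intro ex_cong1) auto
  finally show ?thesis .
qed

lemma proportional_iff:
  fixes p q y z :: real
  assumes "p \<noteq> 0 \<or> q \<noteq> 0"
  shows "(\<exists>t. y = t * p \<and> z = t * q) \<longleftrightarrow> q * y = p * z"
proof
  assume "q * y = p * z"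
  then show "\<exists>t. y = t * p \<and> z = t * q"
    using assms
    by (intro exI[of _ "if p = 0 then z / q else y / p"]) (auto simp: field_simps)
qed auto

text \<open>Write \<open>c = dist A B\<close> and \<open>b = dist C A\<close>. With respect to the
  sides at \<open>A\<close> the sum of the unit vectors has coefficients \<open>1 / c\<close> and
  \<open>1 / b\<close>, so the bisector is given by \<open>y : z = b : c\<close>.\<close>

lemma comb_in_internal_bisector_iff:
  assumes "\<not> collinear {A, B, C}" "x + y + z = 1"
  shows "comb A B C x y z \<in> internal_bisector A B C \<longleftrightarrow> dist A B * y = dist C A * z"
proof -
  have "0 < norm (B - A)" "0 < norm (C - A)"
    using not_collinear_imp_neq[OF assms(1)] by auto
  then show ?thesis
    using comb_in_ray_iff[OF assms, of "inverse (norm (B - A))" "inverse (norm (C - A))"]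
      proportional_iff[of "inverse (norm (B - A))" "inverse (norm (C - A))" y z]
    unfolding internal_bisector_def
    by (simp add: sgn_div_norm dist_norm norm_minus_commute field_simps)
qed

lemma comb_in_external_bisector_iff:
  assumes "\<not> collinear {A, B, C}" "x + y + z = 1"
  shows "comb A B C x y z \<in> external_bisector A B C \<longleftrightarrow> dist A B * y = - dist C A * z"
proof -
  have "0 < norm (B - A)" "0 < norm (C - A)"
    using not_collinear_imp_neq[OF assms(1)] by auto
  then show ?thesis
    using comb_in_ray_iff[OF assms, of "inverse (norm (B - A))" "- inverse (norm (C - A))"]
      proportional_iff[of "inverse (norm (B - A))" "- inverse (norm (C - A))" y z]
    unfolding external_bisector_def
    by (simp add: sgn_div_norm dist_norm norm_minus_commute field_simps) linarith
qed

text \<open>With respect to the unit vectors along the sides, the line to the given point has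
  coefficients \<open>c y\<close> and \<open>b z\<close>. Reflection swaps them, and rescaling to
  the sides gives \<open>b z / c\<close> and \<open>c y / b\<close>. The condition
  \<open>y \<noteq> 0\<close> keeps this direction nonzero.\<close>

lemma comb_in_isogonal_line_iff:
  assumes nc: "\<not> collinear {A, B, C}" and "x + y + z = 1" "x' + y' + z' = 1" "y \<noteq> 0"
  shows "comb A B C x' y' z' \<in> isogonal_line A B C (comb A B C x y z)
    \<longleftrightarrow> (dist A B)\<^sup>2 * y * y' = (dist C A)\<^sup>2 * z * z'"
proof -
  define c b where "c = dist A B" and "b = dist C A"
  have pos: "c > 0" "b > 0"
    using not_collinear_imp_neq[OF nc] by (auto simp: c_def b_def)
  define e f where "e = sgn (B - A)" and "f = sgn (C - A)"
  have e: "B - A = c *\<^sub>R e" and f: "C - A = b *\<^sub>R f"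
    using pos by (auto simp: e_def f_def c_def b_def sgn_div_norm dist_norm norm_minus_commute)
  have "norm e = 1" "norm f = 1"
    using pos by (auto simp: e_def f_def norm_sgn c_def b_def)
  \<comment> \<open>Opposite unit vectors would flatten the triangle, and the axis of the reflection
    would collapse to a point.\<close>
  have "e + f \<noteq> 0"
  proof
    assume "e + f = 0"
    then have "b *\<^sub>R (B - A) + c *\<^sub>R (C - A) = 0"
      unfolding e f by (metis scaleR_right_distrib scaleR_zero_right scaleR_left_commute)
    then have "comb A B C (- b - c) b c = 0"
      by (simp add: comb_def algebra_simps)
    then show False
      using comb_zero[OF nc, of "- b - c" b c] pos by simp
  qed
  have "affine hull {A, comb A B C x y z} = {A + (t * y * c) *\<^sub>R e + (t * z * b) *\<^sub>R f |t. True}"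
    using affine_hull_ray[of A "y *\<^sub>R (B - A) + z *\<^sub>R (C - A)"] unfolding comb_ray[OF assms(2)] e f
    by (simp add: algebra_simps)
  then have "isogonal_line A B C (comb A B C x y z) = {A + (t * z * b) *\<^sub>R e + (t * y * c) *\<^sub>R f |t. True}"
    unfolding isogonal_line_def e_def[symmetric] f_def[symmetric]
    using line_reflection_swap[of e f A] \<open>norm e = 1\<close> \<open>norm f = 1\<close> \<open>e + f \<noteq> 0\<close>
    by (auto simp: image_def)
  also have "\<dots> = {A + t *\<^sub>R ((z * b / c) *\<^sub>R (B - A) + (y * c / b) *\<^sub>R (C - A)) |t. True}"
    using pos unfolding e f by (simp add: algebra_simps)
  also have "\<dots> = affine hull {A, A + ((z * b / c) *\<^sub>R (B - A) + (y * c / b) *\<^sub>R (C - A))}"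
    by (simp add: affine_hull_ray)
  finally have "comb A B C x' y' z' \<in> isogonal_line A B C (comb A B C x y z) \<longleftrightarrow>
      (y * c / b) * y' = (z * b / c) * z'"
    using comb_in_ray_iff[OF nc assms(3)] proportional_iff[of "z * b / c" "y * c / b" y' z'] pos assms(4)
    by simp
  also have "\<dots> \<longleftrightarrow> c\<^sup>2 * y * y' = b\<^sup>2 * z * z'"
    using pos by (simp add: field_simps power2_eq_square)
  finally show ?thesis
    by (simp add: c_def b_def)
qed

section \<open>Centers of a triangle\<close>

text \<open>The pattern for centers given by incidences: in coordinates of sum 1 the incidences turn
  into proportions (\<open>iff\<close>), which leave one solution. The same equivalence, applied to
  the normalized candidate, gives existence.\<close>

lemma incenter_eq:
  assumes nc: "\<not> collinear {A, B, C}"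
  shows "incenter A B C = bary A B C (dist B C) (dist C A) (dist A B)"
proof -
  define a b c where abc: "a = dist B C" "b = dist C A" "c = dist A B"
  have pos: "a > 0" "b > 0" "c > 0"
    using not_collinear_imp_neq[OF nc] by (auto simp: abc)
  have iff: "comb A B C x y z \<in> internal_bisector A B C \<and> comb A B C x y z \<in> internal_bisector B C A \<and>
      comb A B C x y z \<in> internal_bisector C A B \<longleftrightarrow> c * y = b * z \<and> a * z = c * x \<and> b * x = a * y"
    if "x + y + z = 1" for x y z
    using comb_in_internal_bisector_iff[of A B C x y z] comb_in_internal_bisector_iff[of B C A y z x]
      comb_in_internal_bisector_iff[of C A B z x y] nc that
    by (simp add: comb_rotate(1)[of B C A] comb_rotate(2)[of C A B] abc insert_commute add_ac)
  show ?thesis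
    unfolding incenter_def
  proof (rule the_equality)
    fix P
    assume P: "P \<in> internal_bisector A B C \<and> P \<in> internal_bisector B C A \<and> P \<in> internal_bisector C A B"
    obtain x y z where s: "x + y + z = 1" and xyz: "P = comb A B C x y z"
      using comb_exhaust[OF nc] .
    have "c * y = b * z \<and> a * z = c * x \<and> b * x = a * y"
      using P iff[OF s] xyz by auto
    then show "P = bary A B C (dist B C) (dist C A) (dist A B)"
      unfolding xyz abc[symmetric] using s pos
      by (intro comb_eq_baryI[where k = "x / a"]) (auto simp: field_simps)
  next
    have "a / (a + b + c) + b / (a + b + c) + c / (a + b + c) = 1"
      using pos by (intro normalized_sum) simp
    from iff[OF this]
    show "bary A B C (dist B C) (dist C A) (dist A B) \<in> internal_bisector A B C \<and>
        bary A B C (dist B C) (dist C A) (dist A B) \<in> internal_bisector B C A \<and>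
        bary A B C (dist B C) (dist C A) (dist A B) \<in> internal_bisector C A B"
      by (simp add: bary_def abc)
  qed
qed

lemma excenter_eq:
  assumes nc: "\<not> collinear {A, B, C}"
  shows "excenter A B C = bary A B C (- dist B C) (dist C A) (dist A B)"
proof -
  define a b c where abc: "a = dist B C" "b = dist C A" "c = dist A B"
  have pos: "a > 0" "b > 0" "c > 0"
    using not_collinear_imp_neq[OF nc] by (auto simp: abc)
  have iff: "comb A B C x y z \<in> internal_bisector A B C \<and> comb A B C x y z \<in> external_bisector B C A \<and>
      comb A B C x y z \<in> external_bisector C A B \<longleftrightarrow> c * y = b * z \<and> a * z = - c * x \<and> b * x = - a * y"
    if "x + y + z = 1" for x y z
    using comb_in_internal_bisector_iff[of A B C x y z] comb_in_external_bisector_iff[of B C A y z x]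
      comb_in_external_bisector_iff[of C A B z x y] nc that
    by (simp add: comb_rotate(1)[of B C A] comb_rotate(2)[of C A B] abc insert_commute add_ac)
  show ?thesis
    unfolding excenter_def
  proof (rule the_equality)
    fix P
    assume P: "P \<in> internal_bisector A B C \<and> P \<in> external_bisector B C A \<and> P \<in> external_bisector C A B"
    obtain x y z where s: "x + y + z = 1" and xyz: "P = comb A B C x y z"
      using comb_exhaust[OF nc] .
    have "c * y = b * z \<and> a * z = - c * x \<and> b * x = - a * y"
      using P iff[OF s] xyz by auto
    then show "P = bary A B C (- dist B C) (dist C A) (dist A B)"
      unfolding xyz abc[symmetric] using s pos
      by (intro comb_eq_baryI[where k = "- x / a"]) (auto simp: field_simps)
  next
    \<comment> \<open>The strict inequality makes the coordinate sum nonzero, so the candidate is a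
      finite point.\<close>
    have "a < b + c"
      using dist_triangle_strict[OF nc] by (simp add: abc)
    then have "- a / (- a + b + c) + b / (- a + b + c) + c / (- a + b + c) = 1"
      by (intro normalized_sum) simp
    from iff[OF this]
    show "bary A B C (- dist B C) (dist C A) (dist A B) \<in> internal_bisector A B C \<and>
        bary A B C (- dist B C) (dist C A) (dist A B) \<in> external_bisector B C A \<and>
        bary A B C (- dist B C) (dist C A) (dist A B) \<in> external_bisector C A B"
      by (simp add: bary_def abc)
  qed
qed

text \<open>The three reflected lines say that the products \<open>x x'\<close>,
  \<open>y y'\<close>, \<open>z z'\<close> are proportional to the squared sides. The sum in
  \<open>off_circle\<close> is the coordinate sum of the conjugate; it vanishes exactly on the
  circumcircle, whose points have conjugates at infinity.\<close>

lemma isogonal_conjugate_eq: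
  fixes A B C :: point
  defines "a \<equiv> dist B C" and "b \<equiv> dist C A" and "c \<equiv> dist A B"
  assumes nc: "\<not> collinear {A, B, C}" and nz: "x \<noteq> 0" "y \<noteq> 0" "z \<noteq> 0" "x + y + z \<noteq> 0"
    and off_circle: "a\<^sup>2 * y * z + b\<^sup>2 * z * x + c\<^sup>2 * x * y \<noteq> 0"
  shows "isogonal_conjugate A B C (bary A B C x y z) = bary A B C (a\<^sup>2 * y * z) (b\<^sup>2 * z * x) (c\<^sup>2 * x * y)"
proof -
  have pos: "a > 0" "b > 0" "c > 0"
    using not_collinear_imp_neq[OF nc] by (auto simp: a_def b_def c_def)
  define P where "P = bary A B C x y z"
  let ?s = "x + y + z"
  have s1: "x / ?s + y / ?s + z / ?s = 1"
    using nz by (intro normalized_sum) simp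
  have iff: "comb A B C x' y' z' \<in> isogonal_line A B C P \<and> comb A B C x' y' z' \<in> isogonal_line B C A P \<and>
      comb A B C x' y' z' \<in> isogonal_line C A B P \<longleftrightarrow>
      c\<^sup>2 * y * y' = b\<^sup>2 * z * z' \<and> a\<^sup>2 * z * z' = c\<^sup>2 * x * x' \<and> b\<^sup>2 * x * x' = a\<^sup>2 * y * y'"
    if s2: "x' + y' + z' = 1" for x' y' z'
  proof -
    \<comment> \<open>The normalizing sum of the point cancels from each proportion.\<close>
    have div: "p * (q / ?s) * r = p' * (q' / ?s) * r' \<longleftrightarrow> p * q * r = p' * q' * r'" for p q r p' q' r'
      using nz by (simp add: field_simps)
    show ?thesis
      using comb_in_isogonal_line_iff[OF nc s1 s2]
        comb_in_isogonal_line_iff[of B C A "y / ?s" "z / ?s" "x / ?s" y' z' x']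
        comb_in_isogonal_line_iff[of C A B "z / ?s" "x / ?s" "y / ?s" z' x' y'] nc s1 s2 nz
      unfolding P_def bary_def div
      by (simp add: comb_rotate(1)[of B C A] comb_rotate(2)[of C A B] a_def b_def c_def
          insert_commute add_ac)
  qed
  show ?thesis
    unfolding isogonal_conjugate_def P_def[symmetric]
  proof (rule the_equality)
    fix Q
    assume Q: "Q \<in> isogonal_line A B C P \<and> Q \<in> isogonal_line B C A P \<and> Q \<in> isogonal_line C A B P"
    obtain x' y' z' where s: "x' + y' + z' = 1" and xyz: "Q = comb A B C x' y' z'"
      using comb_exhaust[OF nc] .
    have "c\<^sup>2 * y * y' = b\<^sup>2 * z * z'" "a\<^sup>2 * z * z' = c\<^sup>2 * x * x'" "b\<^sup>2 * x * x' = a\<^sup>2 * y * y'"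
      using Q iff[OF s] xyz by auto
    then show "Q = bary A B C (a\<^sup>2 * y * z) (b\<^sup>2 * z * x) (c\<^sup>2 * x * y)"
      unfolding xyz using s pos nz
      by (intro comb_eq_baryI[where k = "x' / (a\<^sup>2 * y * z)"]) (simp_all add: field_simps)
  next
    let ?S = "a\<^sup>2 * y * z + b\<^sup>2 * z * x + c\<^sup>2 * x * y"
    have "a\<^sup>2 * y * z / ?S + b\<^sup>2 * z * x / ?S + c\<^sup>2 * x * y / ?S = 1"
      using off_circle by (intro normalized_sum) simp
    from iff[OF this]
    show "bary A B C (a\<^sup>2 * y * z) (b\<^sup>2 * z * x) (c\<^sup>2 * x * y) \<in> isogonal_line A B C P \<and>
        bary A B C (a\<^sup>2 * y * z) (b\<^sup>2 * z * x) (c\<^sup>2 * x * y) \<in> isogonal_line B C A P \<and>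
        bary A B C (a\<^sup>2 * y * z) (b\<^sup>2 * z * x) (c\<^sup>2 * x * y) \<in> isogonal_line C A B P"
      by (simp add: bary_def)
  qed
qed

lemma centroid_eq: fixes A B C :: point shows "centroid A B C = bary A B C 1 1 1"
  by (simp add: centroid_def bary_def comb_def scaleR_add_right)

lemma lemoine_point_eq:
  fixes A B C :: point
  assumes "\<not> collinear {A, B, C}"
  shows "lemoine_point A B C = bary A B C ((dist B C)\<^sup>2) ((dist C A)\<^sup>2) ((dist A B)\<^sup>2)"
proof -
  have "(dist B C)\<^sup>2 + (dist C A)\<^sup>2 + (dist A B)\<^sup>2 > 0"
    using not_collinear_imp_neq[OF assms] by (intro add_pos_pos) auto
  then show ?thesis
    using isogonal_conjugate_eq[OF assms, of 1 1 1]
    by (simp add: lemoine_point_def centroid_eq)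
qed

section \<open>Perpendicular bisectors, circumcenter and tangents\<close>

lemma bisector_equidistant:
  fixes P A B :: point
  shows "dist P A = dist P B \<longleftrightarrow> (P - A) \<bullet> (B - A) = (dist A B)\<^sup>2 / 2"
proof -
  have "dist P A = dist P B \<longleftrightarrow> (dist P A)\<^sup>2 = (dist P B)\<^sup>2"
    by (simp add: power2_eq_iff_nonneg)
  also have "\<dots> \<longleftrightarrow> (P - A) \<bullet> (B - A) = (dist A B)\<^sup>2 / 2"
    unfolding dist_norm power2_norm_eq_inner
    by (simp add: inner_diff_left inner_diff_right inner_commute) argo
  finally show ?thesis .
qed

text \<open>Expanding one factor of \<open>d \<bullet> d\<close> along the two sides shows that
  \<open>d\<close> is orthogonal to itself. This is the uniqueness argument for both circumcenter
  and orthocenter.\<close>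

lemma orthogonal_to_sides_eq_0:
  fixes A B C :: point
  assumes nc: "\<not> collinear {A, B, C}" and "d \<bullet> (B - A) = 0" "d \<bullet> (C - A) = 0"
  shows "d = 0"
proof -
  obtain x y z where s: "x + y + z = 1" and xyz: "A + d = comb A B C x y z"
    using comb_exhaust[OF nc] .
  have d: "d = y *\<^sub>R (B - A) + z *\<^sub>R (C - A)"
    using xyz unfolding comb_ray[OF s] by simp
  have "d \<bullet> d = y * (d \<bullet> (B - A)) + z * (d \<bullet> (C - A))"
    by (subst (2) d) (simp only: inner_add_right inner_scaleR_right)
  then show ?thesis using assms(2,3) by simp
qed

lemma equidistant_unique:
  fixes A B C :: point
  assumes nc: "\<not> collinear {A, B, C}"
    and "dist P A = dist P B" "dist P A = dist P C" "dist Q A = dist Q B" "dist Q A = dist Q C"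
  shows "P = Q"
proof -
  have "(P - A) \<bullet> (B - A) = (Q - A) \<bullet> (B - A)" "(P - A) \<bullet> (C - A) = (Q - A) \<bullet> (C - A)"
    using assms(2-5) unfolding bisector_equidistant by simp_all
  then have "(P - Q) \<bullet> (B - A) = 0" "(P - Q) \<bullet> (C - A) = 0"
    by (simp_all add: inner_diff_left)
  then show ?thesis
    using orthogonal_to_sides_eq_0[OF nc] by force
qed

lemma circumcenter_eqI:
  assumes nc: "\<not> collinear {A, B, C}" and "dist P A = dist P B" "dist P B = dist P C"
  shows "circumcenter A B C = P"
  unfolding circumcenter_def
  using assms equidistant_unique[OF nc, of _ P] by (intro the_equality) auto

lemma circumcenter_weight_pos:
  fixes A B C :: point
  defines "a \<equiv> dist B C" and "b \<equiv> dist C A" and "c \<equiv> dist A B"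
  assumes nc: "\<not> collinear {A, B, C}"
  shows "a\<^sup>2 * (b\<^sup>2 + c\<^sup>2 - a\<^sup>2) + b\<^sup>2 * (c\<^sup>2 + a\<^sup>2 - b\<^sup>2) + c\<^sup>2 * (a\<^sup>2 + b\<^sup>2 - c\<^sup>2) > 0" (is "?s > 0")
proof -
  have pos: "a > 0" "b > 0" "c > 0"
    using not_collinear_imp_neq[OF nc] by (auto simp: a_def b_def c_def)
  have less: "a < b + c" "b < c + a" "c < a + b"
    using dist_triangle_strict[OF nc] dist_triangle_strict[OF not_collinear_rotate[OF nc]]
      dist_triangle_strict[OF not_collinear_rotate[OF not_collinear_rotate[OF nc]]]
    by (simp_all add: a_def b_def c_def)
  \<comment> \<open>Heron's formula: the sum is 16 times the squared area.\<close>
  have heron: "?s = (a + b + c) * (b + c - a) * (c + a - b) * (a + b - c)"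
    by algebra
  show "?s > 0"
    unfolding heron using pos less by simp
qed

lemma circumcenter_eq_and_equidistant:
  fixes A B C :: point
  defines "a \<equiv> dist B C" and "b \<equiv> dist C A" and "c \<equiv> dist A B"
  assumes nc: "\<not> collinear {A, B, C}"
  shows "circumcenter A B C =
      bary A B C (a\<^sup>2 * (b\<^sup>2 + c\<^sup>2 - a\<^sup>2)) (b\<^sup>2 * (c\<^sup>2 + a\<^sup>2 - b\<^sup>2)) (c\<^sup>2 * (a\<^sup>2 + b\<^sup>2 - c\<^sup>2))"
      (is "_ = bary A B C ?x ?y ?z")
    and "dist (circumcenter A B C) A = dist (circumcenter A B C) B"
    and "dist (circumcenter A B C) A = dist (circumcenter A B C) C"
proof -
  define x y z s where "x = ?x" and "y = ?y" and "z = ?z" and "s = x + y + z"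
  define O' where "O' = bary A B C x y z"
  have pos: "a > 0" "b > 0" "c > 0"
    using not_collinear_imp_neq[OF nc] by (auto simp: a_def b_def c_def)
  have s: "s > 0"
    using circumcenter_weight_pos[OF nc] unfolding s_def x_def y_def z_def a_def b_def c_def .
  have s1: "x / s + y / s + z / s = 1"
    using s unfolding s_def by (intro normalized_sum) simp
  have diff: "O' - A = comb A B C (x / s - 1) (y / s) (z / s)"
    unfolding O'_def bary_def s_def by (simp add: comb_def algebra_simps)
  have AB: "B - A = comb A B C (- 1) 1 0" and AC: "C - A = comb A B C (- 1) 0 1"
    by (simp_all add: comb_def)
  \<comment> \<open>\<open>inner_comb\<close> turns \<open>(O' - A) \<bullet> (B - A)\<close> into
    \<open>c^2 / 2\<close> minus half of this expression divided by \<open>s\<close>; the analogous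
    identity below serves the side \<open>C - A\<close>.\<close>
  have "a\<^sup>2 * z - b\<^sup>2 * z + c\<^sup>2 * x - c\<^sup>2 * y = 0"
    unfolding x_def y_def z_def by algebra
  then have "(a\<^sup>2 * z - b\<^sup>2 * z + c\<^sup>2 * x - c\<^sup>2 * y) / s = 0"
    by simp
  then have "(O' - A) \<bullet> (B - A) = c\<^sup>2 / 2"
    unfolding diff AB using s1
    by (subst inner_comb) (simp_all add: add_divide_distrib diff_divide_distrib algebra_simps
        flip: a_def b_def c_def)
  moreover
  have "a\<^sup>2 * y + b\<^sup>2 * x - b\<^sup>2 * z - c\<^sup>2 * y = 0"
    unfolding x_def y_def z_def by algebra
  then have "(a\<^sup>2 * y + b\<^sup>2 * x - b\<^sup>2 * z - c\<^sup>2 * y) / s = 0"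
    by simp
  then have "(O' - A) \<bullet> (C - A) = b\<^sup>2 / 2"
    unfolding diff AC using s1
    by (subst inner_comb) (simp_all add: add_divide_distrib diff_divide_distrib algebra_simps
        flip: a_def b_def c_def)
  ultimately have *: "dist O' A = dist O' B" "dist O' A = dist O' C"
    unfolding bisector_equidistant by (simp_all add: b_def c_def dist_commute)
  then have "circumcenter A B C = O'"
    by (intro circumcenter_eqI[OF nc]) auto
  then show "circumcenter A B C = bary A B C ?x ?y ?z"
    and "dist (circumcenter A B C) A = dist (circumcenter A B C) B"
    and "dist (circumcenter A B C) A = dist (circumcenter A B C) C"
    using * by (simp_all add: O'_def x_def y_def z_def)
qed

text \<open>Equidistance fixes the inner products of \<open>d\<close> with the two sides at
  \<open>A\<close> as half their squared lengths, so orthogonality to the radius is linear in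
  \<open>y\<close> and \<open>z\<close>.\<close>

lemma comb_in_circum_tangent_iff:
  assumes nc: "\<not> collinear {A, B, C}" and s: "x + y + z = 1"
  shows "comb A B C x y z \<in> circum_tangent A B C \<longleftrightarrow> (dist A B)\<^sup>2 * y + (dist C A)\<^sup>2 * z = 0"
proof -
  define d where "d = circumcenter A B C - A"
  have "d \<bullet> (B - A) = (dist A B)\<^sup>2 / 2" "d \<bullet> (C - A) = (dist C A)\<^sup>2 / 2"
    using circumcenter_eq_and_equidistant(2,3)[OF nc]
    unfolding bisector_equidistant d_def by (simp_all add: dist_commute)
  then have "d \<bullet> (y *\<^sub>R (B - A) + z *\<^sub>R (C - A)) = ((dist A B)\<^sup>2 * y + (dist C A)\<^sup>2 * z) / 2"
    by (simp only: inner_add_right inner_scaleR_right) (simp add: field_simps)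
  moreover have "comb A B C x y z - A = y *\<^sub>R (B - A) + z *\<^sub>R (C - A)" "A - circumcenter A B C = - d"
    unfolding comb_ray[OF s] d_def by simp_all
  ultimately have "(comb A B C x y z - A) \<bullet> (A - circumcenter A B C) = - ((dist A B)\<^sup>2 * y + (dist C A)\<^sup>2 * z) / 2"
    by (simp only: inner_minus_right inner_commute[of _ d])
  then show ?thesis
    unfolding circum_tangent_def orthogonal_def by auto
qed

text \<open>The excluded case is a right angle at \<open>A\<close>: \<open>B C\<close> is then a
  diameter and the tangents at its ends are parallel. Excentral triangles are acute, so they avoid
  it.\<close>

lemma tangential_vertex_eq:
  fixes A B C :: point
  defines "a \<equiv> dist B C" and "b \<equiv> dist C A" and "c \<equiv> dist A B"
  assumes nc: "\<not> collinear {A, B, C}" and not_right: "- a\<^sup>2 + b\<^sup>2 + c\<^sup>2 \<noteq> 0"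
  shows "tangential_vertex A B C = bary A B C (- a\<^sup>2) (b\<^sup>2) (c\<^sup>2)"
proof -
  have pos: "a > 0" "b > 0" "c > 0"
    using not_collinear_imp_neq[OF nc] by (auto simp: a_def b_def c_def)
  have iff: "comb A B C x y z \<in> circum_tangent B C A \<and> comb A B C x y z \<in> circum_tangent C A B \<longleftrightarrow>
      a\<^sup>2 * z + c\<^sup>2 * x = 0 \<and> b\<^sup>2 * x + a\<^sup>2 * y = 0" if "x + y + z = 1" for x y z
    using comb_in_circum_tangent_iff[of B C A y z x] comb_in_circum_tangent_iff[of C A B z x y] nc that
    by (simp add: comb_rotate(1)[of B C A] comb_rotate(2)[of C A B] a_def b_def c_def
        insert_commute add_ac)
  show ?thesis
    unfolding tangential_vertex_def
  proof (rule the_equality)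
    fix P
    assume P: "P \<in> circum_tangent B C A \<and> P \<in> circum_tangent C A B"
    obtain x y z where s: "x + y + z = 1" and xyz: "P = comb A B C x y z"
      using comb_exhaust[OF nc] .
    have "a\<^sup>2 * z + c\<^sup>2 * x = 0 \<and> b\<^sup>2 * x + a\<^sup>2 * y = 0"
      using P iff[OF s] xyz by auto
    then show "P = bary A B C (- a\<^sup>2) (b\<^sup>2) (c\<^sup>2)"
      unfolding xyz using s pos
      by (intro comb_eq_baryI[where k = "- x / a\<^sup>2"]) (auto simp: field_simps)
  next
    let ?S = "- a\<^sup>2 + b\<^sup>2 + c\<^sup>2"
    have "- a\<^sup>2 / ?S + b\<^sup>2 / ?S + c\<^sup>2 / ?S = 1"
      using not_right by (rule normalized_sum)
    from iff[OF this]
    show "bary A B C (- a\<^sup>2) (b\<^sup>2) (c\<^sup>2) \<in> circum_tangent B C A \<and>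
        bary A B C (- a\<^sup>2) (b\<^sup>2) (c\<^sup>2) \<in> circum_tangent C A B"
      by (simp add: bary_def)
  qed
qed

section \<open>Cubics in barycentric coordinates\<close>

definition poly3 :: "(nat \<Rightarrow> nat \<Rightarrow> real) \<Rightarrow> point \<Rightarrow> real" where
  "poly3 c P = (\<Sum>i\<le>3. \<Sum>j\<le>3 - i. c i j * (P $ 1) ^ i * (P $ 2) ^ j)"

text \<open>The mixed coefficients are paired by side: 3 and 4 survive on \<open>x = 0\<close>, 5
  and 6 on \<open>y = 0\<close>, 7 and 8 on \<open>z = 0\<close>, so that each midpoint relates one
  pair.\<close>

definition hom3 :: "(nat \<Rightarrow> real) \<Rightarrow> real \<Rightarrow> real \<Rightarrow> real \<Rightarrow> real" where
  "hom3 d x y z = d 0 * x^3 + d 1 * y^3 + d 2 * z^3 + d 3 * (y\<^sup>2 * z) + d 4 * (y * z\<^sup>2) +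
     d 5 * (z\<^sup>2 * x) + d 6 * (z * x\<^sup>2) + d 7 * (x\<^sup>2 * y) + d 8 * (x * y\<^sup>2) + d 9 * (x * y * z)"

text \<open>The determinant with rows \<open>(x, y, z)\<close>,
  \<open>(a^2 y z, b^2 z x, c^2 x y)\<close> and \<open>(1, 1, 1)\<close>.\<close>

definition thomson_form :: "real \<Rightarrow> real \<Rightarrow> real \<Rightarrow> real \<Rightarrow> real \<Rightarrow> real \<Rightarrow> real" where
  "thomson_form a b c x y z =
     x * (c\<^sup>2 * y\<^sup>2 - b\<^sup>2 * z\<^sup>2) + y * (a\<^sup>2 * z\<^sup>2 - c\<^sup>2 * x\<^sup>2) + z * (b\<^sup>2 * x\<^sup>2 - a\<^sup>2 * y\<^sup>2)"

text \<open>On a polynomial of degree at most 3 it is 6 times the cubic part evaluated at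
  \<open>v\<close>, which makes the exact degree visible without reference to axes.\<close>

definition third_difference :: "(point \<Rightarrow> real) \<Rightarrow> point \<Rightarrow> point \<Rightarrow> real" where
  "third_difference f P v = f (P + 3 *\<^sub>R v) - 3 * f (P + 2 *\<^sub>R v) + 3 * f (P + v) - f P"

text \<open>The first barycentric coordinate as a ratio of signed areas; this form is visibly affine
  in \<open>P\<close>.\<close>

definition coord :: "point \<Rightarrow> point \<Rightarrow> point \<Rightarrow> point \<Rightarrow> real" where
  "coord A B C P = cross2 (P - B) (C - B) / cross2 (A - B) (C - B)"

lemma poly3_expand:
  "poly3 c P = c 0 0 + c 0 1 * P$2 + c 0 2 * (P$2)^2 + c 0 3 * (P$2)^3 + c 1 0 * P$1
     + c 1 1 * P$1 * P$2 + c 1 2 * P$1 * (P$2)^2 + c 2 0 * (P$1)^2 + c 2 1 * (P$1)^2 * P$2 + c 3 0 * (P$1)^3"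
  by (simp add: poly3_def numeral_eq_Suc atMost_Suc)

lemma third_difference_poly3:
  "third_difference (poly3 c) P v = 6 * (c 3 0 * (v$1)^3 + c 2 1 * (v$1)\<^sup>2 * v$2 + c 1 2 * v$1 * (v$2)\<^sup>2 + c 0 3 * (v$2)^3)"
proof -
  obtain p q r s where "P $ 1 = p" "P $ 2 = q" "v $ 1 = r" "v $ 2 = s"
    by blast
  then show ?thesis
    unfolding third_difference_def poly3_expand
    by (simp add: algebra_simps power2_eq_square power3_eq_cube)
qed

lemma leading_coeff_iff:
  "(\<exists>i\<le>3. c i (3 - i) \<noteq> 0) \<longleftrightarrow> (\<exists>P v. third_difference (poly3 c) P v \<noteq> 0)"
proof -
  have all: "(\<forall>i\<le>3. c i (3 - i) = 0) \<longleftrightarrow> c 0 3 = 0 \<and> c 1 2 = 0 \<and> c 2 1 = 0 \<and> c 3 0 = 0"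
    by (auto simp: numeral_eq_Suc le_Suc_eq)
  have "(\<forall>i\<le>3. c i (3 - i) = 0) \<longleftrightarrow> (\<forall>P v. third_difference (poly3 c) P v = 0)"
  proof
    assume "\<forall>P v. third_difference (poly3 c) P v = 0"
    then have *: "c 3 0 * r^3 + c 2 1 * r\<^sup>2 * s + c 1 2 * r * s\<^sup>2 + c 0 3 * s^3 = 0" for r s
      using third_difference_poly3[of c 0 "vector [r, s]"] by simp
    \<comment> \<open>A binary cubic form vanishing in four pairwise independent directions is
      zero.\<close>
    show "\<forall>i\<le>3. c i (3 - i) = 0"
      unfolding all using *[of 1 0] *[of 0 1] *[of 1 1] *[of 1 "-1"] by auto
  qed (simp add: all third_difference_poly3)
  then show ?thesis by blast
qed

lemma cubic_curve_iff:
  "cubic_curve K \<longleftrightarrow> (\<exists>c. (\<exists>P v. third_difference (poly3 c) P v \<noteq> 0) \<and> K = {P. poly3 c P = 0})"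
  unfolding cubic_curve_def leading_coeff_iff poly3_def ..

lemma coord_comb:
  assumes "\<not> collinear {A, B, C}" "x + y + z = 1"
  shows "coord A B C (comb A B C x y z) = x"
proof -
  have "\<not> collinear {B, A, C}"
    using assms(1) by (simp add: insert_commute)
  then have "cross2 (A - B) (C - B) \<noteq> 0"
    by (simp add: collinear_iff_cross2)
  moreover have y: "y = 1 - x - z"
    using assms(2) by simp
  have "cross2 (comb A B C x y z - B) (C - B) = x * cross2 (A - B) (C - B)"
    unfolding y by (simp add: comb_def cross2_def algebra_simps)
  ultimately show ?thesis
    by (simp add: coord_def)
qed

lemma coord_affine: "\<exists>p q r. \<forall>P. coord A B C P = p * P$1 + q * P$2 + r"
  unfolding coord_def cross2_def
  by (rule exI[of _ "(C - B)$2 / cross2 (A - B) (C - B)"], rule exI[of _ "- (C - B)$1 / cross2 (A - B) (C - B)"],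
      rule exI[of _ "(B$2 * (C - B)$1 - B$1 * (C - B)$2) / cross2 (A - B) (C - B)"])
    (simp add: cross2_def field_simps flip: add_divide_distrib diff_divide_distrib)

section \<open>Passage between Cartesian cubics and ternary forms\<close>

lemma poly3_linear_combination: "\<exists>e. \<forall>P. k * poly3 c P + l * poly3 d P = poly3 e P"
  by (rule exI[of _ "\<lambda>i j. k * c i j + l * d i j"]) (simp add: poly3_expand algebra_simps)

text \<open>The witness is the table of expanded coefficients; row \<open>i\<close> has
  \<open>4 - i\<close> entries, matching the range \<open>j \<le> 3 - i\<close>.\<close>

lemma poly3_affine_product:
  "\<exists>c. \<forall>P. (p1 * P$1 + q1 * P$2 + r1) * (p2 * P$1 + q2 * P$2 + r2) * (p3 * P$1 + q3 * P$2 + r3) = poly3 c P"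
  by (rule exI[of _ "\<lambda>i j. [[r1*r2*r3, q1*r2*r3 + r1*q2*r3 + r1*r2*q3, q1*q2*r3 + q1*r2*q3 + r1*q2*q3, q1*q2*q3],
      [p1*r2*r3 + r1*p2*r3 + r1*r2*p3, p1*q2*r3 + p1*r2*q3 + q1*p2*r3 + r1*p2*q3 + q1*r2*p3 + r1*q2*p3,
       p1*q2*q3 + q1*p2*q3 + q1*q2*p3],
      [p1*p2*r3 + p1*r2*p3 + r1*p2*p3, p1*p2*q3 + p1*q2*p3 + q1*p2*p3], [p1*p2*p3]] ! i ! j"])
    (simp add: poly3_expand numeral_eq_Suc algebra_simps)

lemma hom3_linear_combination: "\<exists>e. \<forall>x y z. k * hom3 c x y z + l * hom3 d x y z = hom3 e x y z"
  by (rule exI[of _ "\<lambda>i. k * c i + l * d i"]) (simp add: hom3_def algebra_simps)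

lemma hom3_linear_product:
  "\<exists>d. \<forall>x y z. (p1 * x + q1 * y + r1 * z) * (p2 * x + q2 * y + r2 * z) * (p3 * x + q3 * y + r3 * z) = hom3 d x y z"
  by (rule exI[of _ "\<lambda>i. [p1*p2*p3, q1*q2*q3, r1*r2*r3,
      q1*q2*r3 + q1*r2*q3 + r1*q2*q3, q1*r2*r3 + r1*q2*r3 + r1*r2*q3,
      r1*r2*p3 + r1*p2*r3 + p1*r2*r3, r1*p2*p3 + p1*r2*p3 + p1*p2*r3,
      p1*p2*q3 + p1*q2*p3 + q1*p2*p3, p1*q2*q3 + q1*p2*q3 + q1*q2*p3,
      p1*q2*r3 + p1*r2*q3 + q1*p2*r3 + r1*p2*q3 + q1*r2*p3 + r1*q2*p3] ! i"])
    (simp add: hom3_def numeral_eq_Suc algebra_simps)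

text \<open>Homogenization: a monomial of degree below 3 is padded with factors
  \<open>s = x + y + z\<close>, which equal 1 on normalized coordinates. Closure of cubic forms
  under sums and products of linear forms replaces an explicit list of the new coefficients.\<close>

lemma poly3_comb_eq_hom3:
  "\<exists>d. \<forall>x y z. x + y + z = 1 \<longrightarrow> poly3 c (comb A B C x y z) = hom3 d x y z"
proof -
  define is_hom3 where "is_hom3 = (\<lambda>f. \<exists>d. \<forall>x y z. f x y z = hom3 d x y z)"
  have add: "is_hom3 (\<lambda>x y z. f x y z + g x y z)" if "is_hom3 f" "is_hom3 g" for f g
    using that hom3_linear_combination[of 1 _ 1] unfolding is_hom3_def by fastforce
  have scale: "is_hom3 (\<lambda>x y z. k * f x y z)" if "is_hom3 f" for k f
    using that hom3_linear_combination[of k _ 0] unfolding is_hom3_def by fastforce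
  define l where "l = (\<lambda>i x y z. x * A$i + y * B$i + z * C$i)"
  define s where "s = (\<lambda>x y z :: real. x + y + z)"
  define lin where "lin = (\<lambda>f. \<exists>p q r. \<forall>x y z. f x y z = p * x + q * y + r * (z::real) )"
  have prod: "is_hom3 (\<lambda>x y z. f x y z * g x y z * h x y z)" if "lin f" "lin g" "lin h" for f g h
    using that hom3_linear_product unfolding is_hom3_def lin_def by fastforce
  have lin: "lin (l i)" "lin s" for i
    unfolding lin_def l_def s_def
    by (rule exI[of _ "A$i"], rule exI[of _ "B$i"], rule exI[of _ "C$i"], simp)
       (rule exI[of _ 1], rule exI[of _ 1], rule exI[of _ 1], simp)
  let ?t = "\<lambda>k f g h x y z. k * (f x y z * g x y z * h x y z)"
  have "is_hom3 (\<lambda>x y z. ?t (c 0 0) s s s x y z + ?t (c 0 1) s s (l 2) x y z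
     + ?t (c 0 2) s (l 2) (l 2) x y z + ?t (c 0 3) (l 2) (l 2) (l 2) x y z
     + ?t (c 1 0) s s (l 1) x y z + ?t (c 1 1) s (l 1) (l 2) x y z + ?t (c 1 2) (l 1) (l 2) (l 2) x y z
     + ?t (c 2 0) s (l 1) (l 1) x y z + ?t (c 2 1) (l 1) (l 1) (l 2) x y z + ?t (c 3 0) (l 1) (l 1) (l 1) x y z)"
    by (intro add scale prod lin)
  then obtain d where "\<forall>x y z. ?t (c 0 0) s s s x y z + ?t (c 0 1) s s (l 2) x y z
     + ?t (c 0 2) s (l 2) (l 2) x y z + ?t (c 0 3) (l 2) (l 2) (l 2) x y z
     + ?t (c 1 0) s s (l 1) x y z + ?t (c 1 1) s (l 1) (l 2) x y z + ?t (c 1 2) (l 1) (l 2) (l 2) x y z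
     + ?t (c 2 0) s (l 1) (l 1) x y z + ?t (c 2 1) (l 1) (l 1) (l 2) x y z + ?t (c 3 0) (l 1) (l 1) (l 1) x y z
     = hom3 d x y z"
    unfolding is_hom3_def by blast
  then have "poly3 c (comb A B C x y z) = hom3 d x y z" if "x + y + z = 1" for x y z
  proof -
    have "s x y z = 1" "comb A B C x y z $ i = l i x y z" for i
      using that by (simp_all add: s_def l_def comb_def)
    then show ?thesis
      using \<open>\<forall>x y z. _\<close>[rule_format, of x y z]
      by (simp add: poly3_expand power2_eq_square power3_eq_cube mult.assoc)
  qed
  then show ?thesis by blast
qed

lemma hom3_homogeneous: "hom3 d (k * x) (k * y) (k * z) = k ^ 3 * hom3 d x y z"
  by (simp add: hom3_def power_mult_distrib algebra_simps power2_eq_square power3_eq_cube)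

text \<open>The vertices kill the cubes and each midpoint makes one pair of mixed coefficients
  opposite. The four centers differ only by signs: \<open>X\<close>, \<open>Y\<close>,
  \<open>Z\<close> collect the terms odd in just one variable and \<open>S\<close> the term odd in
  all, and the resulting 4 by 4 sign system is invertible.\<close>

lemma hom3_eq_thomson_form:
  assumes pos: "a > 0" "b > 0" "c > 0"
    and vertices: "hom3 d 1 0 0 = 0" "hom3 d 0 1 0 = 0" "hom3 d 0 0 1 = 0"
    and midpoints: "hom3 d 0 1 1 = 0" "hom3 d 1 0 1 = 0" "hom3 d 1 1 0 = 0"
    and centers: "hom3 d a b c = 0" "hom3 d (- a) b c = 0" "hom3 d a (- b) c = 0" "hom3 d a b (- c) = 0"
  shows "\<exists>k. \<forall>x y z. hom3 d x y z = k * thomson_form a b c x y z"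
proof -
  have d: "d 0 = 0" "d 1 = 0" "d 2 = 0" "d 4 = - d 3" "d 6 = - d 5" "d 8 = - d 7"
    using vertices midpoints by (simp_all add: hom3_def)
  define X where "X = d 5 * (c\<^sup>2 * a) + d 8 * (a * b\<^sup>2)"
  define Y where "Y = d 4 * (b * c\<^sup>2) + d 7 * (a\<^sup>2 * b)"
  define Z where "Z = d 3 * (b\<^sup>2 * c) + d 6 * (c * a\<^sup>2)"
  define S where "S = d 9 * (a * b * c)"
  have "X + Y + Z + S = 0" "- X + Y + Z - S = 0" "X - Y + Z - S = 0" "X + Y - Z - S = 0"
    using centers unfolding hom3_def d(1-3) X_def Y_def Z_def S_def by (simp_all add: algebra_simps)
  then have zero: "X = 0" "Y = 0" "Z = 0" "S = 0"
    by linarith+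
  \<comment> \<open>The Thomson form has coefficient \<open>- c^2\<close> at \<open>x^2 y\<close>,
    so \<open>d 7\<close> fixes the factor.\<close>
  define k where "k = - d 7 / c\<^sup>2"
  have d7: "d 7 = - k * c\<^sup>2"
    using pos by (simp add: k_def)
  have "(a * c\<^sup>2) * d 5 = (a * c\<^sup>2) * (- k * b\<^sup>2)"
    using zero(1) unfolding X_def d d7 by (simp add: algebra_simps)
  then have d5: "d 5 = - k * b\<^sup>2"
    using pos by (subst (asm) mult_left_cancel) auto
  have "(b * c\<^sup>2) * d 3 = (b * c\<^sup>2) * (- k * a\<^sup>2)"
    using zero(2) unfolding Y_def d d7 by (simp add: algebra_simps)
  then have d3: "d 3 = - k * a\<^sup>2"
    using pos by (subst (asm) mult_left_cancel) auto
  have d9: "d 9 = 0"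
    using zero(4) pos by (simp add: S_def)
  have "hom3 d x y z = k * thomson_form a b c x y z" for x y z
    unfolding hom3_def thomson_form_def d d7 d5 d3 d9 by (simp add: algebra_simps)
  then show ?thesis by blast
qed

lemma thomson_form_homogeneous:
  "thomson_form a b c (k * x) (k * y) (k * z) = k ^ 3 * thomson_form a b c x y z"
  by (simp add: thomson_form_def power_mult_distrib algebra_simps power2_eq_square power3_eq_cube)

lemma cubic_curve_thomson_form:
  fixes A B C :: point and a b c :: real
  defines "F \<equiv> \<lambda>P. thomson_form a b c (coord A B C P) (coord B C A P) (coord C A B P)"
  assumes nc: "\<not> collinear {A, B, C}" and "c \<noteq> 0"
  shows "cubic_curve {P. F P = 0}"
proof -
  define is_poly3 where "is_poly3 = (\<lambda>f. \<exists>e. \<forall>P. f P = poly3 e P)"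
  have add: "is_poly3 (\<lambda>P. f P + g P)" if "is_poly3 f" "is_poly3 g" for f g
    using that poly3_linear_combination[of 1 _ 1] unfolding is_poly3_def by fastforce
  have scale: "is_poly3 (\<lambda>P. k * f P)" if "is_poly3 f" for k f
    using that poly3_linear_combination[of k _ 0] unfolding is_poly3_def by fastforce
  define aff where "aff = (\<lambda>f :: point \<Rightarrow> real. \<exists>p q r. \<forall>P. f P = p * P$1 + q * P$2 + r)"
  have prod: "is_poly3 (\<lambda>P. f P * g P * h P)" if "aff f" "aff g" "aff h" for f g h
    using that poly3_affine_product unfolding is_poly3_def aff_def by fastforce
  define X Y Z where "X = coord A B C" and "Y = coord B C A" and "Z = coord C A B"
  have aff: "aff X" "aff Y" "aff Z"
    unfolding aff_def X_def Y_def Z_def by (rule coord_affine)+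
  have F: "F = (\<lambda>P. c\<^sup>2 * (X P * Y P * Y P) + - b\<^sup>2 * (X P * Z P * Z P) + a\<^sup>2 * (Y P * Z P * Z P)
      + - c\<^sup>2 * (Y P * X P * X P) + b\<^sup>2 * (Z P * X P * X P) + - a\<^sup>2 * (Z P * Y P * Y P))"
    by (rule ext) (simp add: F_def thomson_form_def X_def Y_def Z_def algebra_simps power2_eq_square)
  have "is_poly3 F"
    unfolding F by (intro add scale prod aff)
  then obtain e where e: "F = poly3 e"
    unfolding is_poly3_def by blast
  have F_side: "F (A + t *\<^sub>R (B - A)) = c\<^sup>2 * ((1 - t) * t\<^sup>2 - t * (1 - t)\<^sup>2)" for t
  proof -
    have "A + t *\<^sub>R (B - A) = comb A B C (1 - t) t 0"
      by (simp add: comb_def algebra_simps)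
    moreover have "coord A B C (comb A B C (1 - t) t 0) = 1 - t" "coord B C A (comb A B C (1 - t) t 0) = t"
      "coord C A B (comb A B C (1 - t) t 0) = 0"
      using coord_comb[OF nc, of "1 - t" t 0] coord_comb[of B C A t 0 "1 - t"] coord_comb[of C A B 0 "1 - t" t] nc
      by (simp_all add: comb_rotate(1)[of B C A] comb_rotate(2)[of C A B] insert_commute)
    ultimately show ?thesis
      unfolding F_def by (simp only: thomson_form_def) (simp add: algebra_simps)
  qed
  \<comment> \<open>On the side the form is \<open>c^2 t (1 - t) (2 t - 1)\<close>, with leading
    term \<open>- 2 c^2 t^3\<close>; the third difference is 6 times that coefficient.\<close>
  have "third_difference F A (B - A) = - 12 * c\<^sup>2"
    using F_side[of 0] F_side[of 1] F_side[of 2] F_side[of 3]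
    unfolding third_difference_def by simp
  then have "third_difference (poly3 e) A (B - A) \<noteq> 0"
    using assms(3) by (simp add: e)
  then show ?thesis
    unfolding cubic_curve_iff e by blast
qed

section \<open>The excentral triangle\<close>

lemma bary_ray:
  assumes "x + y + z \<noteq> 0"
  shows "bary A B C x y z = A + (1 / (x + y + z)) *\<^sub>R (y *\<^sub>R (B - A) + z *\<^sub>R (C - A))"
  unfolding bary_def comb_ray[OF normalized_sum[OF assms]] by (simp add: scaleR_add_right)

text \<open>Seen from \<open>A\<close>, the four points use only two directions, those of the two
  bisectors: \<open>b (B - A)\<close> and \<open>c (C - A)\<close> are the unit vectors along the
  sides times \<open>b c\<close>. Angles and lengths of the excentral triangle reduce to these two
  vectors.\<close>

lemma excenters_rays:
  fixes A B C :: point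
  defines "a \<equiv> dist B C" and "b \<equiv> dist C A" and "c \<equiv> dist A B"
  assumes nc: "\<not> collinear {A, B, C}"
  shows "incenter A B C = A + (1 / (a + b + c)) *\<^sub>R (b *\<^sub>R (B - A) + c *\<^sub>R (C - A))"
    and "excenter A B C = A + (1 / (b + c - a)) *\<^sub>R (b *\<^sub>R (B - A) + c *\<^sub>R (C - A))"
    and "excenter B C A = A - (1 / (c + a - b)) *\<^sub>R (b *\<^sub>R (B - A) - c *\<^sub>R (C - A))"
    and "excenter C A B = A + (1 / (a + b - c)) *\<^sub>R (b *\<^sub>R (B - A) - c *\<^sub>R (C - A))"
proof -
  have nc': "\<not> collinear {B, C, A}" "\<not> collinear {C, A, B}"
    using nc by (simp_all add: insert_commute)
  have pos: "a > 0" "b > 0" "c > 0"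
    using not_collinear_imp_neq[OF nc] by (auto simp: a_def b_def c_def)
  have less: "a < b + c" "b < c + a" "c < a + b"
    using dist_triangle_strict[OF nc] dist_triangle_strict[OF nc'(1)] dist_triangle_strict[OF nc'(2)]
    by (simp_all add: a_def b_def c_def)
  show "incenter A B C = A + (1 / (a + b + c)) *\<^sub>R (b *\<^sub>R (B - A) + c *\<^sub>R (C - A))"
    using pos unfolding incenter_eq[OF nc] a_def[symmetric] b_def[symmetric] c_def[symmetric]
    by (subst bary_ray) auto
  show "excenter A B C = A + (1 / (b + c - a)) *\<^sub>R (b *\<^sub>R (B - A) + c *\<^sub>R (C - A))"
    using less unfolding excenter_eq[OF nc] a_def[symmetric] b_def[symmetric] c_def[symmetric]
    by (subst bary_ray) (simp_all add: algebra_simps)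
  have "excenter B C A = bary A B C a (- b) c"
    using excenter_eq[OF nc'(1)] bary_rotate(1)[of B C A "-b" c a] by (simp add: a_def b_def c_def)
  also have "\<dots> = A + (1 / (c + a - b)) *\<^sub>R ((- b) *\<^sub>R (B - A) + c *\<^sub>R (C - A))"
    using less by (subst bary_ray) (simp_all add: add_ac)
  finally show "excenter B C A = A - (1 / (c + a - b)) *\<^sub>R (b *\<^sub>R (B - A) - c *\<^sub>R (C - A))"
    by (simp add: algebra_simps)
  have "excenter C A B = bary A B C a b (- c)"
    using excenter_eq[OF nc'(2)] bary_rotate(2)[of C A B "-c" a b] by (simp add: a_def b_def c_def)
  also have "\<dots> = A + (1 / (a + b - c)) *\<^sub>R (b *\<^sub>R (B - A) + (- c) *\<^sub>R (C - A))"
    using less by (subst bary_ray) (simp_all add: add_ac)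
  finally show "excenter C A B = A + (1 / (a + b - c)) *\<^sub>R (b *\<^sub>R (B - A) - c *\<^sub>R (C - A))"
    by simp
qed

text \<open>The two summands have equal length, so their sum and difference are
  perpendicular.\<close>

lemma bisector_directions_orthogonal:
  fixes A B C :: point
  shows "(dist C A *\<^sub>R (B - A) + dist A B *\<^sub>R (C - A)) \<bullet> (dist C A *\<^sub>R (B - A) - dist A B *\<^sub>R (C - A)) = 0"
proof -
  obtain e f where ef: "B - A = e" "C - A = f"
    by blast
  have "e \<bullet> e = (dist A B)\<^sup>2" "f \<bullet> f = (dist C A)\<^sup>2"
    unfolding ef[symmetric] by (simp_all only: dist_norm norm_minus_commute[of A B] power2_norm_eq_inner)
  then show ?thesis
    unfolding ef
    by (simp add: inner_add_left inner_diff_right inner_commute[of f e] power2_eq_square algebra_simps)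
qed

lemma orthogonal_incenter_excenter:
  fixes A B C :: point
  assumes nc: "\<not> collinear {A, B, C}"
  shows "orthogonal (excenter A B C - A) (excenter C A B - excenter B C A)"
    and "orthogonal (incenter A B C - excenter A B C) (excenter C A B - excenter B C A)"
proof -
  let ?p = "dist C A *\<^sub>R (B - A) + dist A B *\<^sub>R (C - A)"
  let ?q = "dist C A *\<^sub>R (B - A) - dist A B *\<^sub>R (C - A)"
  note rays = excenters_rays[OF nc]
  have "\<exists>s. excenter A B C - A = s *\<^sub>R ?p"
    unfolding rays by (metis add_diff_cancel_left')
  moreover have "\<exists>s. incenter A B C - excenter A B C = s *\<^sub>R ?p"
    unfolding rays by (metis add_diff_cancel_left scaleR_diff_left)
  moreover have "\<exists>s. excenter C A B - excenter B C A = s *\<^sub>R ?q"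
  proof -
    have "A + k *\<^sub>R ?q - (A - l *\<^sub>R ?q) = (k + l) *\<^sub>R ?q" for k l
      unfolding scaleR_add_left by simp
    then show ?thesis unfolding rays by blast
  qed
  moreover have "orthogonal (s *\<^sub>R ?p) (t *\<^sub>R ?q)" for s t
    using bisector_directions_orthogonal[of C A B] by (simp add: orthogonal_def)
  ultimately show "orthogonal (excenter A B C - A) (excenter C A B - excenter B C A)"
    and "orthogonal (incenter A B C - excenter A B C) (excenter C A B - excenter B C A)"
    by metis+
qed

text \<open>The two excenters lie on opposite rays from \<open>A\<close> along \<open>?q\<close>, so
  their ray parameters add up. By the law of cosines \<open>?q\<close> has squared length
  \<open>b c (a^2 - (b - c)^2)\<close>, which factors.\<close>

lemma dist_excenters:
  fixes A B C :: point
  defines "a \<equiv> dist B C" and "b \<equiv> dist C A" and "c \<equiv> dist A B"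
  assumes nc: "\<not> collinear {A, B, C}"
  shows "(dist (excenter B C A) (excenter C A B))\<^sup>2 = 4 * a\<^sup>2 * b * c / ((c + a - b) * (a + b - c))"
proof -
  have nc': "\<not> collinear {B, C, A}" "\<not> collinear {C, A, B}"
    using nc by (simp_all add: insert_commute)
  have less: "b < c + a" "c < a + b"
    using dist_triangle_strict[OF nc'(1)] dist_triangle_strict[OF nc'(2)]
    by (simp_all add: a_def b_def c_def)
  let ?q = "b *\<^sub>R (B - A) - c *\<^sub>R (C - A)"
  let ?k = "1 / (a + b - c) + 1 / (c + a - b)"
  have "excenter C A B - excenter B C A = ?k *\<^sub>R ?q"
    unfolding excenters_rays[OF nc, folded a_def b_def c_def] scaleR_add_left by simp
  then have "(dist (excenter B C A) (excenter C A B))\<^sup>2 = ?k\<^sup>2 * (?q \<bullet> ?q)"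
    unfolding dist_norm norm_minus_commute[of "excenter B C A"] power2_norm_eq_inner
    by (simp only: inner_scaleR_left inner_scaleR_right) (simp only: power2_eq_square mult.assoc)
  also have "?q \<bullet> ?q = b * c * (c + a - b) * (a + b - c)"
  proof -
    have "?q = comb A B C (c - b) b (- c)"
      by (simp add: comb_def algebra_simps)
    then have "?q \<bullet> ?q = - (a\<^sup>2 * (b * - c + - c * b) + b\<^sup>2 * (- c * (c - b) + (c - b) * - c) + c\<^sup>2 * ((c - b) * b + b * (c - b))) / 2"
      using inner_comb[of "c - b" b "- c" "c - b" b "- c" A B C] by (simp add: a_def b_def c_def)
    also have "\<dots> = b * c * (c + a - b) * (a + b - c)"
      by (simp add: field_simps power2_eq_square)
    finally show ?thesis .
  qed
  also have "?k = 2 * a / ((c + a - b) * (a + b - c))"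
    using less by (simp add: add_frac_eq field_simps)
  also have "(2 * a / ((c + a - b) * (a + b - c)))\<^sup>2 * (b * c * (c + a - b) * (a + b - c)) =
      4 * a\<^sup>2 * b * c / ((c + a - b) * (a + b - c))"
    using less by (simp add: divide_simps power2_eq_square)
  finally show ?thesis .
qed

text \<open>Change of coordinates from the excentral to the reference triangle. The factors
  \<open>b + c - a\<close> etc. are the coordinate sums of the excenters, so the scaled excenters
  have the polynomial weights \<open>(- a, b, c)\<close> etc. and no denominators appear.\<close>

lemma bary_excenters:
  fixes A B C :: point
  defines "a \<equiv> dist B C" and "b \<equiv> dist C A" and "c \<equiv> dist A B"
  assumes nc: "\<not> collinear {A, B, C}"
  shows "bary (excenter A B C) (excenter B C A) (excenter C A B)
      ((b + c - a) * p) ((c + a - b) * q) ((a + b - c) * r) =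
    bary A B C (a * (q + r - p)) (b * (r + p - q)) (c * (p + q - r))"
proof -
  have nc': "\<not> collinear {B, C, A}" "\<not> collinear {C, A, B}"
    using nc by (simp_all add: insert_commute)
  have less: "a < b + c" "b < c + a" "c < a + b"
    using dist_triangle_strict[OF nc] dist_triangle_strict[OF nc'(1)] dist_triangle_strict[OF nc'(2)]
    by (simp_all add: a_def b_def c_def)
  have unnormalized: "s *\<^sub>R bary A B C x y z = comb A B C x y z" if "x + y + z = s" "s \<noteq> 0" for s x y z
    using that by (simp add: bary_def comb_def scaleR_add_right)
  have A': "(b + c - a) *\<^sub>R excenter A B C = comb A B C (- a) b c"
    using unnormalized[of "- a" b c "b + c - a"] less by (simp add: excenter_eq[OF nc] a_def b_def c_def)
  have B': "(c + a - b) *\<^sub>R excenter B C A = comb A B C a (- b) c"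
    using unnormalized[of a "- b" c "c + a - b"] less bary_rotate(1)[of B C A "-b" c a]
    by (simp add: excenter_eq[OF nc'(1)] a_def b_def c_def add_ac)
  have C': "(a + b - c) *\<^sub>R excenter C A B = comb A B C a b (- c)"
    using unnormalized[of a b "- c" "a + b - c"] less bary_rotate(2)[of C A B "-c" a b]
    by (simp add: excenter_eq[OF nc'(2)] a_def b_def c_def add_ac)
  have comb: "comb (excenter A B C) (excenter B C A) (excenter C A B)
      ((b + c - a) * p) ((c + a - b) * q) ((a + b - c) * r) =
    comb A B C (a * (q + r - p)) (b * (r + p - q)) (c * (p + q - r))" for p q r
  proof -
    have "comb (excenter A B C) (excenter B C A) (excenter C A B)
        ((b + c - a) * p) ((c + a - b) * q) ((a + b - c) * r) =
      p *\<^sub>R (b + c - a) *\<^sub>R excenter A B C + q *\<^sub>R (c + a - b) *\<^sub>R excenter B C A + r *\<^sub>R (a + b - c) *\<^sub>R excenter C A B"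
      unfolding comb_def by (simp add: mult.commute)
    also have "\<dots> = comb A B C (a * (q + r - p)) (b * (r + p - q)) (c * (p + q - r))"
      unfolding A' B' C' by (simp add: comb_def algebra_simps)
    finally show ?thesis .
  qed
  \<comment> \<open>The total weights agree, hence so do the normalizations; for sum 0 both sides
    are the default value \<open>0\<close>.\<close>
  have sum: "(b + c - a) * p + (c + a - b) * q + (a + b - c) * r =
      a * (q + r - p) + b * (r + p - q) + c * (p + q - r)"
    by (simp add: algebra_simps)
  have scale: "bary X Y Z x y z = (1 / (x + y + z)) *\<^sub>R comb X Y Z x y z" for X Y Z x y z
    by (simp add: bary_def comb_def scaleR_add_right)
  show ?thesis
    unfolding scale comb sum ..
qed

text \<open>The determinant of two sides is bilinear in the bisector directions and comes out as a
  positive multiple of that of the reference triangle.\<close>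

lemma not_collinear_excenters:
  fixes A B C :: point
  assumes nc: "\<not> collinear {A, B, C}"
  shows "\<not> collinear {excenter A B C, excenter B C A, excenter C A B}"
proof -
  define a b c where abc: "a = dist B C" "b = dist C A" "c = dist A B"
  have nc': "\<not> collinear {B, C, A}" "\<not> collinear {C, A, B}"
    using nc by (simp_all add: insert_commute)
  have pos: "a > 0" "b > 0" "c > 0"
    using not_collinear_imp_neq[OF nc] by (auto simp: abc)
  have less: "a < b + c" "b < c + a" "c < a + b"
    using dist_triangle_strict[OF nc] dist_triangle_strict[OF nc'(1)] dist_triangle_strict[OF nc'(2)]
    by (simp_all add: abc)
  let ?u = "b *\<^sub>R (B - A)" and ?v = "c *\<^sub>R (C - A)"
  define p q r where "p = 1 / (b + c - a)" and "q = 1 / (c + a - b)" and "r = 1 / (a + b - c)"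
  have pqr: "p > 0" "q > 0" "r > 0"
    using less by (simp_all add: p_def q_def r_def)
  have AB: "excenter B C A - excenter A B C = - (q + p) *\<^sub>R ?u + (q - p) *\<^sub>R ?v"
    and AC: "excenter C A B - excenter A B C = (r - p) *\<^sub>R ?u - (r + p) *\<^sub>R ?v"
    unfolding excenters_rays[OF nc, folded abc] p_def q_def r_def
    by (simp_all only: scaleR_add_left scaleR_diff_left scaleR_add_right scaleR_diff_right scaleR_minus_left) simp_all
  have cross: "cross2 (k *\<^sub>R x + l *\<^sub>R y) (m *\<^sub>R x - n *\<^sub>R y) = - (k * n + l * m) * cross2 x y" for k l m n x y
    by (simp add: cross2_def algebra_simps)
  have "cross2 (excenter B C A - excenter A B C) (excenter C A B - excenter A B C) =
      - (- (q + p) * (r + p) + (q - p) * (r - p)) * cross2 ?u ?v"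
    unfolding AB AC cross ..
  also have "\<dots> = 2 * p * (q + r) * b * c * cross2 (B - A) (C - A)"
    by (simp add: cross2_def algebra_simps)
  also have "\<dots> \<noteq> 0"
    using pos pqr nc by (simp add: collinear_iff_cross2)
  finally show ?thesis
    by (simp add: collinear_iff_cross2)
qed

lemma perp_foot_excenter:
  fixes A B C :: point
  assumes nc: "\<not> collinear {A, B, C}"
  shows "perp_foot (excenter A B C) (excenter B C A) (excenter C A B) = A"
proof (rule perp_foot_eqI)
  show "excenter B C A \<noteq> excenter C A B"
    using not_collinear_imp_neq[OF not_collinear_excenters[OF nc]] by auto
  show "orthogonal (excenter A B C - A) (excenter C A B - excenter B C A)"
    by (rule orthogonal_incenter_excenter[OF nc])
  define a b c where abc: "a = dist B C" "b = dist C A" "c = dist A B"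
  have pos: "a > 0"
    using not_collinear_imp_neq[OF nc] by (auto simp: abc)
  \<comment> \<open>The parameters \<open>p = 0\<close>, \<open>q = r = 1\<close> in the change of
    coordinates give \<open>(2 a, 0, 0)\<close>, which exhibits \<open>A\<close> on the line through
    the other two excenters.\<close>
  have "A = bary A B C (a * (1 + 1 - 0)) (b * (1 + 0 - 1)) (c * (0 + 1 - 1))"
    using pos by (simp add: bary_def comb_def)
  also have "\<dots> = bary (excenter A B C) (excenter B C A) (excenter C A B) 0 (c + a - b) (a + b - c)"
    using bary_excenters[OF nc, of 0 1 1] by (simp add: abc)
  finally have A: "A = ((c + a - b) / (2 * a)) *\<^sub>R excenter B C A + ((a + b - c) / (2 * a)) *\<^sub>R excenter C A B"
    by (simp add: bary_def comb_def)
  moreover have "(c + a - b) / (2 * a) + (a + b - c) / (2 * a) = 1"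
    using pos by (simp add: field_simps)
  ultimately show "A \<in> affine hull {excenter B C A, excenter C A B}"
    unfolding affine_hull_2 by blast
qed

lemma incenter_rotate: "\<not> collinear {A, B, C} \<Longrightarrow> incenter B C A = incenter A B C" for A B C :: point
  using incenter_eq[of A B C] incenter_eq[of B C A] bary_rotate(1)[of B C A]
  by (simp add: insert_commute)

lemma orthocenter_excenters:
  fixes A B C :: point
  assumes nc: "\<not> collinear {A, B, C}"
  shows "orthocenter (excenter A B C) (excenter B C A) (excenter C A B) = incenter A B C"
  unfolding orthocenter_def
proof (rule the_equality)
  have nc': "\<not> collinear {B, C, A}" "\<not> collinear {C, A, B}"
    using nc by (simp_all add: insert_commute)
  let ?A = "excenter A B C" and ?B = "excenter B C A" and ?C = "excenter C A B"
  show I: "orthogonal (incenter A B C - ?A) (?C - ?B) \<and> orthogonal (incenter A B C - ?B) (?A - ?C)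
      \<and> orthogonal (incenter A B C - ?C) (?B - ?A)"
    using orthogonal_incenter_excenter(2)[OF nc] orthogonal_incenter_excenter(2)[OF nc'(1)]
      orthogonal_incenter_excenter(2)[OF nc'(2)] incenter_rotate[OF nc] incenter_rotate[OF nc'(1)]
    by simp
  fix P
  assume P: "orthogonal (P - ?A) (?C - ?B) \<and> orthogonal (P - ?B) (?A - ?C) \<and> orthogonal (P - ?C) (?B - ?A)"
  have "(P - incenter A B C) \<bullet> (?B - ?A) = 0" "(P - incenter A B C) \<bullet> (?C - ?A) = 0"
    using P I by (simp_all add: orthogonal_def inner_diff_left inner_diff_right)
  then show "P = incenter A B C"
    using orthogonal_to_sides_eq_0[OF not_collinear_excenters[OF nc]] by force
qed

text \<open>The power of a point with respect to the circumcircle, read in barycentric coordinates;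
  a point lies on the circle when the subtracted sum vanishes.\<close>

lemma dist_circumcenter_comb:
  fixes A B C :: point
  assumes nc: "\<not> collinear {A, B, C}" and s: "x + y + z = 1"
  shows "(dist (circumcenter A B C) (comb A B C x y z))\<^sup>2 = (dist (circumcenter A B C) A)\<^sup>2
    - ((dist B C)\<^sup>2 * y * z + (dist C A)\<^sup>2 * z * x + (dist A B)\<^sup>2 * x * y)"
proof -
  define d where "d = circumcenter A B C - A"
  define e where "e = comb A B C x y z - A"
  have d: "d \<bullet> (B - A) = (dist A B)\<^sup>2 / 2" "d \<bullet> (C - A) = (dist C A)\<^sup>2 / 2"
    using circumcenter_eq_and_equidistant(2,3)[OF nc]
    unfolding bisector_equidistant d_def by (simp_all add: dist_commute)
  have "e = y *\<^sub>R (B - A) + z *\<^sub>R (C - A)"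
    unfolding e_def comb_ray[OF s] by simp
  then have de: "d \<bullet> e = ((dist A B)\<^sup>2 * y + (dist C A)\<^sup>2 * z) / 2"
    by (simp only: inner_add_right inner_scaleR_right d) (simp add: field_simps)
  have "e = comb A B C (x - 1) y z"
    by (simp add: e_def comb_def algebra_simps)
  then have ee: "e \<bullet> e = - ((dist B C)\<^sup>2 * (2 * y * z) + (dist C A)\<^sup>2 * (2 * z * (x - 1)) + (dist A B)\<^sup>2 * (2 * (x - 1) * y)) / 2"
    using inner_comb[of "x - 1" y z "x - 1" y z A B C] s by (simp add: algebra_simps)
  have "circumcenter A B C - comb A B C x y z = d - e"
    by (simp add: d_def e_def)
  then have "(dist (circumcenter A B C) (comb A B C x y z))\<^sup>2 = (d - e) \<bullet> (d - e)"
    by (simp add: dist_norm power2_norm_eq_inner)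
  also have "\<dots> = d \<bullet> d - 2 * (d \<bullet> e) + e \<bullet> e"
    by (simp add: inner_diff_left inner_diff_right inner_commute)
  also have "d \<bullet> d = (dist (circumcenter A B C) A)\<^sup>2"
    by (simp add: d_def dist_norm power2_norm_eq_inner)
  finally show ?thesis
    unfolding de ee by (simp add: field_simps)
qed

lemma midpoint_excenters_on_circumcircle:
  fixes A B C :: point
  assumes nc: "\<not> collinear {A, B, C}"
  shows "dist (circumcenter A B C) (midpoint (excenter B C A) (excenter C A B)) = dist (circumcenter A B C) A"
proof -
  define a b c where abc: "a = dist B C" "b = dist C A" "c = dist A B"
  have nc': "\<not> collinear {B, C, A}" "\<not> collinear {C, A, B}"
    using nc by (simp_all add: insert_commute)
  have less: "b < c + a" "c < a + b"
    using dist_triangle_strict[OF nc'(1)] dist_triangle_strict[OF nc'(2)]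
    by (simp_all add: abc)
  let ?v = "c + a - b" and ?w = "a + b - c"
  \<comment> \<open>Half of what \<open>bary_excenters\<close> returns for
    \<open>(0, ?w, ?v)\<close>: the weights of the midpoint become
    \<open>(0, ?v * ?w, ?w * ?v)\<close>, and \<open>?v + ?w = 2 * a\<close>,
    \<open>?v - ?w = 2 * (c - b)\<close>.\<close>
  define x y z where "x = a\<^sup>2" and "y = b * (c - b)" and "z = c * (b - c)"
  define s where "s = x + y + z"
  have s: "s = ?v * ?w"
    unfolding s_def x_def y_def z_def by algebra
  have "s \<noteq> 0"
    using less s by simp
  have "midpoint (excenter B C A) (excenter C A B) = bary (excenter A B C) (excenter B C A) (excenter C A B) 0 1 1"
    by (simp add: midpoint_def bary_def comb_def scaleR_add_right)
  also have "\<dots> = bary (excenter A B C) (excenter B C A) (excenter C A B) ((b + c - a) * 0) (?v * ?w) (?w * ?v)"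
    using bary_scale[of "?v * ?w" "excenter A B C" "excenter B C A" "excenter C A B" 0 1 1] less
    by (simp add: mult.commute)
  also have "\<dots> = bary A B C (a * (?w + ?v)) (b * (?v - ?w)) (c * (?w - ?v))"
    using bary_excenters[OF nc, of 0 ?w ?v] by (simp add: abc)
  also have "\<dots> = bary A B C (2 * x) (2 * y) (2 * z)"
    by (simp add: x_def y_def z_def algebra_simps power2_eq_square)
  also have "\<dots> = comb A B C (x / s) (y / s) (z / s)"
    unfolding bary_scale[of 2, OF zero_neq_numeral[symmetric]] by (simp add: bary_def s_def)
  finally have M: "midpoint (excenter B C A) (excenter C A B) = comb A B C (x / s) (y / s) (z / s)" .
  have s1: "x / s + y / s + z / s = 1"
    using \<open>s \<noteq> 0\<close> unfolding s_def by (rule normalized_sum)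
  have "a\<^sup>2 * y * z + b\<^sup>2 * z * x + c\<^sup>2 * x * y = 0"
    unfolding x_def y_def z_def by algebra
  then have "(a\<^sup>2 * y * z + b\<^sup>2 * z * x + c\<^sup>2 * x * y) / s\<^sup>2 = 0"
    by simp
  then have "a\<^sup>2 * (y / s) * (z / s) + b\<^sup>2 * (z / s) * (x / s) + c\<^sup>2 * (x / s) * (y / s) = 0"
    by (simp add: add_divide_distrib power2_eq_square)
  then have "(dist (circumcenter A B C) (comb A B C (x / s) (y / s) (z / s)))\<^sup>2 = (dist (circumcenter A B C) A)\<^sup>2"
    using dist_circumcenter_comb[OF nc s1] by (simp add: abc)
  then show ?thesis
    by (simp add: M)
qed

lemma not_collinear_midpoints:
  fixes A B C :: point
  assumes nc: "\<not> collinear {A, B, C}"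
  shows "\<not> collinear {midpoint B C, midpoint C A, midpoint A B}"
proof -
  have "midpoint C A - midpoint B C = (- 1/2) *\<^sub>R (B - A)" "midpoint A B - midpoint B C = (- 1/2) *\<^sub>R (C - A)"
    by (simp_all add: midpoint_def algebra_simps)
  moreover have "cross2 ((- 1/2) *\<^sub>R x) ((- 1/2) *\<^sub>R y) = cross2 x y / 4" for x y
    by (simp add: cross2_def)
  ultimately show ?thesis
    using nc by (simp only: collinear_iff_cross2)
qed

lemma circumcenter_rotate: "circumcenter B C A = circumcenter A B C"
proof -
  have "dist P B = dist P C \<and> dist P C = dist P A \<longleftrightarrow> dist P A = dist P B \<and> dist P B = dist P C" for P
    by auto
  then show ?thesis
    unfolding circumcenter_def by simp
qed

text \<open>The vertices of the medial triangle of the excentral triangle lie on the circumcircle of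
  \<open>A B C\<close>, so the two triangles share their circumcenter.\<close>

lemma nine_point_center_excenters:
  fixes A B C :: point
  assumes nc: "\<not> collinear {A, B, C}"
  shows "nine_point_center (excenter A B C) (excenter B C A) (excenter C A B) = circumcenter A B C"
proof -
  have nc': "\<not> collinear {B, C, A}" "\<not> collinear {C, A, B}"
    using nc by (simp_all add: insert_commute)
  have rot: "circumcenter B C A = circumcenter A B C" "circumcenter C A B = circumcenter A B C"
    by (metis circumcenter_rotate)+
  show ?thesis
    unfolding nine_point_center_def
    using midpoint_excenters_on_circumcircle[OF nc] midpoint_excenters_on_circumcircle[OF nc'(1)]
      midpoint_excenters_on_circumcircle[OF nc'(2)] circumcenter_eq_and_equidistant(2,3)[OF nc] rot
    by (intro circumcenter_eqI not_collinear_midpoints not_collinear_excenters nc) simp_all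
qed

text \<open>Expanding each fraction by its missing factor makes \<open>4 a b c / (u v w)\<close>
  common to the three squared sides. Lemoine point and tangential triangle have homogeneous
  coordinates in the squared sides, so only the ratios matter.\<close>

lemma dist_excenters_proportional:
  fixes A B C :: point
  defines "a \<equiv> dist B C" and "b \<equiv> dist C A" and "c \<equiv> dist A B"
  assumes nc: "\<not> collinear {A, B, C}"
  obtains k where "k > 0"
    "(dist (excenter B C A) (excenter C A B))\<^sup>2 = k * ((b + c - a) * a)"
    "(dist (excenter C A B) (excenter A B C))\<^sup>2 = k * ((c + a - b) * b)"
    "(dist (excenter A B C) (excenter B C A))\<^sup>2 = k * ((a + b - c) * c)"
proof
  have nc': "\<not> collinear {B, C, A}" "\<not> collinear {C, A, B}"
    using nc by (simp_all add: insert_commute)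
  have pos: "a > 0" "b > 0" "c > 0"
    using not_collinear_imp_neq[OF nc] by (auto simp: a_def b_def c_def)
  have less: "a < b + c" "b < c + a" "c < a + b"
    using dist_triangle_strict[OF nc] dist_triangle_strict[OF nc'(1)] dist_triangle_strict[OF nc'(2)]
    by (simp_all add: a_def b_def c_def)
  define u v w where uvw: "u = b + c - a" "v = c + a - b" "w = a + b - c"
  have uvw_pos: "u > 0" "v > 0" "w > 0"
    using less by (simp_all add: uvw)
  let ?k = "4 * a * b * c / (u * v * w)"
  show "?k > 0"
    using pos uvw_pos by simp
  have d: "(dist (excenter B C A) (excenter C A B))\<^sup>2 = 4 * a\<^sup>2 * b * c / (v * w)"
    "(dist (excenter C A B) (excenter A B C))\<^sup>2 = 4 * b\<^sup>2 * c * a / (w * u)"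
    "(dist (excenter A B C) (excenter B C A))\<^sup>2 = 4 * c\<^sup>2 * a * b / (u * v)"
    using dist_excenters[OF nc] dist_excenters[OF nc'(1)] dist_excenters[OF nc'(2)]
    by (simp_all add: a_def b_def c_def uvw)
  show "(dist (excenter B C A) (excenter C A B))\<^sup>2 = ?k * ((b + c - a) * a)"
    "(dist (excenter C A B) (excenter A B C))\<^sup>2 = ?k * ((c + a - b) * b)"
    "(dist (excenter A B C) (excenter B C A))\<^sup>2 = ?k * ((a + b - c) * c)"
    unfolding d uvw[symmetric] using uvw_pos by (simp_all add: field_simps power2_eq_square)
qed

text \<open>The squared sides of the excentral triangle, up to a common factor, already have the
  shape expected by \<open>bary_excenters\<close>, with parameters \<open>a\<close>,
  \<open>b\<close>, \<open>c\<close>.\<close>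

lemma mittenpunkt_eq:
  fixes A B C :: point
  defines "a \<equiv> dist B C" and "b \<equiv> dist C A" and "c \<equiv> dist A B"
  assumes nc: "\<not> collinear {A, B, C}"
  shows "mittenpunkt A B C = bary A B C (a * (b + c - a)) (b * (c + a - b)) (c * (a + b - c))"
proof -
  obtain k where "k > 0" and
    k: "(dist (excenter B C A) (excenter C A B))\<^sup>2 = k * ((b + c - a) * a)"
    "(dist (excenter C A B) (excenter A B C))\<^sup>2 = k * ((c + a - b) * b)"
    "(dist (excenter A B C) (excenter B C A))\<^sup>2 = k * ((a + b - c) * c)"
    using dist_excenters_proportional[OF nc] unfolding a_def b_def c_def by blast
  have "mittenpunkt A B C = lemoine_point (excenter A B C) (excenter B C A) (excenter C A B)"
    by (simp add: mittenpunkt_def excentral_triangle_def)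
  also have "\<dots> = bary (excenter A B C) (excenter B C A) (excenter C A B)
      ((b + c - a) * a) ((c + a - b) * b) ((a + b - c) * c)"
    unfolding lemoine_point_eq[OF not_collinear_excenters[OF nc]] k using \<open>k > 0\<close>
    by (intro bary_scale) simp
  also have "\<dots> = bary A B C (a * (b + c - a)) (b * (c + a - b)) (c * (a + b - c))"
    unfolding a_def b_def c_def by (rule bary_excenters[OF nc])
  finally show ?thesis .
qed

text \<open>All coordinates of the mittenpunkt are positive, so it is off the sides and off the
  circumcircle; the factor \<open>a b c\<close> cancels from its conjugate.\<close>

lemma isogonal_conjugate_mittenpunkt_eq:
  fixes A B C :: point
  defines "a \<equiv> dist B C" and "b \<equiv> dist C A" and "c \<equiv> dist A B"
  defines "u \<equiv> b + c - a" and "v \<equiv> c + a - b" and "w \<equiv> a + b - c"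
  assumes nc: "\<not> collinear {A, B, C}"
  shows "isogonal_conjugate A B C (mittenpunkt A B C) = bary A B C (a * v * w) (b * w * u) (c * u * v)"
proof -
  have nc': "\<not> collinear {B, C, A}" "\<not> collinear {C, A, B}"
    using nc by (simp_all add: insert_commute)
  have pos: "a > 0" "b > 0" "c > 0"
    using not_collinear_imp_neq[OF nc] by (auto simp: a_def b_def c_def)
  have uvw_pos: "u > 0" "v > 0" "w > 0"
    using dist_triangle_strict[OF nc] dist_triangle_strict[OF nc'(1)] dist_triangle_strict[OF nc'(2)]
    by (simp_all add: a_def b_def c_def u_def v_def w_def)
  have "isogonal_conjugate A B C (mittenpunkt A B C) =
      bary A B C (a\<^sup>2 * (b * v) * (c * w)) (b\<^sup>2 * (c * w) * (a * u)) (c\<^sup>2 * (a * u) * (b * v))"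
    unfolding mittenpunkt_eq[OF nc, folded a_def b_def c_def, folded u_def v_def w_def]
    unfolding a_def b_def c_def
  proof (rule isogonal_conjugate_eq[OF nc], fold a_def b_def c_def)
    have "a * u + b * v + c * w > 0"
      using pos uvw_pos by (intro add_pos_pos mult_pos_pos)
    then show "a * u + b * v + c * w \<noteq> 0"
      by simp
    have "a\<^sup>2 * (b * v) * (c * w) + b\<^sup>2 * (c * w) * (a * u) + c\<^sup>2 * (a * u) * (b * v) > 0"
      using pos uvw_pos by (intro add_pos_pos mult_pos_pos) simp_all
    then show "a\<^sup>2 * (b * v) * (c * w) + b\<^sup>2 * (c * w) * (a * u) + c\<^sup>2 * (a * u) * (b * v) \<noteq> 0"
      by simp
  qed (use pos uvw_pos in auto)
  also have "\<dots> = bary A B C ((a * b * c) * (a * v * w)) ((a * b * c) * (b * w * u)) ((a * b * c) * (c * u * v))"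
    by (simp add: power2_eq_square mult_ac)
  also have "\<dots> = bary A B C (a * v * w) (b * w * u) (c * u * v)"
    using pos by (intro bary_scale) simp
  finally show ?thesis .
qed

section \<open>Tangential triangle and Thomson cubic\<close>

text \<open>The subtracted combination and the factor of \<open>A\<close> are the same at all three
  vertices. In this form the homothety \<open>X \<mapsto> k X - W\<close> is explicit.\<close>

lemma tangential_vertex_excenters:
  fixes A B C :: point
  defines "a \<equiv> dist B C" and "b \<equiv> dist C A" and "c \<equiv> dist A B"
  defines "u \<equiv> b + c - a" and "v \<equiv> c + a - b" and "w \<equiv> a + b - c"
  assumes nc: "\<not> collinear {A, B, C}"
  shows "tangential_vertex (excenter A B C) (excenter B C A) (excenter C A B) =
    (4 * a * b * c / (u * v * w)) *\<^sub>R A - comb A B C (a / u) (b / v) (c / w)"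
proof -
  have nc': "\<not> collinear {B, C, A}" "\<not> collinear {C, A, B}"
    using nc by (simp_all add: insert_commute)
  have pos: "a > 0" "b > 0" "c > 0"
    using not_collinear_imp_neq[OF nc] by (auto simp: a_def b_def c_def)
  have uvw_pos: "u > 0" "v > 0" "w > 0"
    using dist_triangle_strict[OF nc] dist_triangle_strict[OF nc'(1)] dist_triangle_strict[OF nc'(2)]
    by (simp_all add: a_def b_def c_def u_def v_def w_def)
  obtain k where "k > 0" and
    k: "(dist (excenter B C A) (excenter C A B))\<^sup>2 = k * (u * a)"
    "(dist (excenter C A B) (excenter A B C))\<^sup>2 = k * (v * b)"
    "(dist (excenter A B C) (excenter B C A))\<^sup>2 = k * (w * c)"
    using dist_excenters_proportional[OF nc] unfolding a_def b_def c_def u_def v_def w_def by blast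
  \<comment> \<open>Positivity of \<open>v w\<close> says that the angle at this excenter is acute,
    which supplies the nonzero sum required by \<open>tangential_vertex_eq\<close>.\<close>
  have vw: "- (u * a) + v * b + w * c = v * w"
    unfolding u_def v_def w_def by algebra
  have "- (k * (u * a)) + k * (v * b) + k * (w * c) = k * (v * w)"
    unfolding vw[symmetric] by (simp add: algebra_simps)
  then have nz: "- (k * (u * a)) + k * (v * b) + k * (w * c) \<noteq> 0"
    using uvw_pos \<open>k > 0\<close> by simp
  have "tangential_vertex (excenter A B C) (excenter B C A) (excenter C A B) =
      bary (excenter A B C) (excenter B C A) (excenter C A B) (- (k * (u * a))) (k * (v * b)) (k * (w * c))"
    using tangential_vertex_eq[OF not_collinear_excenters[OF nc]] nz unfolding k by blast
  also have "\<dots> = bary (excenter A B C) (excenter B C A) (excenter C A B) (u * - a) (v * b) (w * c)"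
    using bary_scale[of k "excenter A B C" "excenter B C A" "excenter C A B" "u * - a" "v * b" "w * c"] \<open>k > 0\<close>
    by simp
  also have "\<dots> = bary A B C (a * (b + c - - a)) (b * (c + - a - b)) (c * (- a + b - c))"
    using bary_excenters[OF nc, of "- a" b c] by (simp only: a_def b_def c_def u_def v_def w_def)
  also have "\<dots> = bary A B C (a * (a + b + c)) (- (b * w)) (- (c * v))"
    by (simp add: v_def w_def algebra_simps)
  also have "\<dots> = comb A B C (a * (a + b + c) / (v * w)) (- (b * w) / (v * w)) (- (c * v) / (v * w))"
  proof -
    have "a * (a + b + c) + - (b * w) + - (c * v) = v * w"
      unfolding v_def w_def by algebra
    then show ?thesis
      unfolding bary_def by simp
  qed
  also have "a * (a + b + c) / (v * w) = 4 * a * b * c / (u * v * w) - a / u"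
  proof -
    obtain t where t: "t = a + b + c"
      by blast
    \<comment> \<open>Here \<open>u t = (b + c)^2 - a^2\<close> and
      \<open>v w = a^2 - (b - c)^2\<close>; the partial fractions below come from this sum.\<close>
    have "4 * b * c = u * t + v * w"
      unfolding t u_def v_def w_def by algebra
    then have "4 * a * b * c = a * (u * t + v * w)"
      by (simp add: mult_ac)
    moreover have "a * (u * t + v * w) / (u * v * w) = a * t / (v * w) + a / u"
      using uvw_pos by (simp add: field_simps)
    ultimately have "4 * a * b * c / (u * v * w) = a * t / (v * w) + a / u"
      by (simp only:)
    then show ?thesis
      unfolding t[symmetric] by linarith
  qed
  also have "- (b * w) / (v * w) = - (b / v)"
    using uvw_pos by simp
  also have "- (c * v) / (v * w) = - (c / w)"
    using uvw_pos by simp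
  finally show ?thesis
    by (simp add: comb_def algebra_simps)
qed

text \<open>Two distinct vertices determine the ratio, and a ratio other than 1 has a single fixed
  point.\<close>

lemma homothetic_center_eqI:
  assumes "k \<noteq> 0" "k \<noteq> 1" "X1 \<noteq> X2"
    and "Y1 = S + k *\<^sub>R (X1 - S)" "Y2 = S + k *\<^sub>R (X2 - S)" "Y3 = S + k *\<^sub>R (X3 - S)"
  shows "homothetic_center (X1, X2, X3) (Y1, Y2, Y3) = S"
  unfolding homothetic_center.simps
proof (rule the_equality)
  fix T
  assume "\<exists>l. l \<noteq> 0 \<and> Y1 = T + l *\<^sub>R (X1 - T) \<and> Y2 = T + l *\<^sub>R (X2 - T) \<and> Y3 = T + l *\<^sub>R (X3 - T)"
  then obtain l where l: "Y1 = T + l *\<^sub>R (X1 - T)" "Y2 = T + l *\<^sub>R (X2 - T)"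
    by blast
  have "Y1 - Y2 = k *\<^sub>R (X1 - X2)"
    unfolding assms(4,5) by (simp add: algebra_simps)
  moreover have "Y1 - Y2 = l *\<^sub>R (X1 - X2)"
    unfolding l by (simp add: algebra_simps)
  ultimately have "l = k"
    using assms(3) by simp
  then have "T + k *\<^sub>R (X1 - T) = S + k *\<^sub>R (X1 - S)"
    using l(1) assms(4) by simp
  then have "(1 - k) *\<^sub>R (T - S) = 0"
    by (simp add: algebra_simps)
  then show "T = S"
    using assms(2) by simp
qed (use assms in blast)

lemma homothetic_center_excenters:
  fixes A B C :: point
  assumes nc: "\<not> collinear {A, B, C}"
  shows "homothetic_center (A, B, C)
      (tangential_triangle (excenter A B C) (excenter B C A) (excenter C A B)) =
    isogonal_conjugate A B C (mittenpunkt A B C)"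
proof -
  have nc': "\<not> collinear {B, C, A}" "\<not> collinear {C, A, B}"
    using nc by (simp_all add: insert_commute)
  define a b c where abc: "a = dist B C" "b = dist C A" "c = dist A B"
  define u v w where uvw: "u = b + c - a" "v = c + a - b" "w = a + b - c"
  have pos: "a > 0" "b > 0" "c > 0"
    using not_collinear_imp_neq[OF nc] by (auto simp: abc)
  have uvw_pos: "u > 0" "v > 0" "w > 0"
    using dist_triangle_strict[OF nc] dist_triangle_strict[OF nc'(1)] dist_triangle_strict[OF nc'(2)]
    by (simp_all add: abc uvw)
  define k where "k = 4 * a * b * c / (u * v * w)"
  define W where "W = comb A B C (a / u) (b / v) (c / w)"
  define s where "s = a * v * w + b * w * u + c * u * v"
  define S where "S = bary A B C (a * v * w) (b * w * u) (c * u * v)"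
  have "s > 0"
    using pos uvw_pos unfolding s_def by (intro add_pos_pos mult_pos_pos)
  \<comment> \<open>This identity makes \<open>1 - k\<close> negative, so the homothety is not a
    translation.\<close>
  have "4 * a * b * c = u * v * w + s"
    unfolding s_def uvw by algebra
  then have k: "1 - k = - s / (u * v * w)"
    using uvw_pos by (simp add: k_def field_simps)
  have "s *\<^sub>R S = comb A B C (a * v * w) (b * w * u) (c * u * v)"
    using \<open>s > 0\<close> by (simp add: S_def bary_def s_def[symmetric] comb_def scaleR_add_right)
  also have "\<dots> = (u * v * w) *\<^sub>R W"
    using uvw_pos by (simp add: W_def comb_def scaleR_add_right mult_ac)
  finally have "(1 / (u * v * w)) *\<^sub>R s *\<^sub>R S = W"
    using uvw_pos by simp
  then have W: "(1 - k) *\<^sub>R S = - W"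
    by (simp add: k)
  \<comment> \<open>The map \<open>X \<mapsto> k X - W\<close> has fixed point \<open>S\<close>,
    since \<open>(1 - k) S = - W\<close>.\<close>
  have S: "S + k *\<^sub>R (X - S) = k *\<^sub>R X - W" for X
    using W by (simp add: algebra_simps)
  have "homothetic_center (A, B, C) (k *\<^sub>R A - W, k *\<^sub>R B - W, k *\<^sub>R C - W) = S"
  proof (rule homothetic_center_eqI)
    show "k \<noteq> 0"
      using pos uvw_pos by (simp add: k_def)
    have "1 - k < 0"
      using \<open>s > 0\<close> uvw_pos by (simp add: k)
    then show "k \<noteq> 1" by simp
    show "A \<noteq> B" using not_collinear_imp_neq[OF nc] by auto
  qed (simp_all add: S)
  moreover have "tangential_vertex (excenter A B C) (excenter B C A) (excenter C A B) = k *\<^sub>R A - W"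
    using tangential_vertex_excenters[OF nc, folded abc, folded uvw] unfolding k_def W_def .
  moreover have "tangential_vertex (excenter B C A) (excenter C A B) (excenter A B C) = k *\<^sub>R B - W"
    using tangential_vertex_excenters[OF nc'(1), folded abc, folded uvw]
    unfolding k_def W_def comb_rotate(1)[of B C A] by (simp add: mult_ac)
  moreover have "tangential_vertex (excenter C A B) (excenter A B C) (excenter B C A) = k *\<^sub>R C - W"
    using tangential_vertex_excenters[OF nc'(2), folded abc, folded uvw]
    unfolding k_def W_def comb_rotate(2)[of C A B] by (simp add: mult_ac)
  ultimately show ?thesis
    unfolding tangential_triangle_def isogonal_conjugate_mittenpunkt_eq[OF nc, folded abc, folded uvw]
    by (simp add: S_def)
qed

text \<open>The two points are isogonal conjugates, so both values are multiples of one bracket;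
  only the vanishing of that bracket depends on what \<open>u\<close>, \<open>v\<close>,
  \<open>w\<close> stand for.\<close>

lemma thomson_form_mittenpunkt:
  fixes a b c :: real
  defines "u \<equiv> b + c - a" and "v \<equiv> c + a - b" and "w \<equiv> a + b - c"
  shows "thomson_form a b c (a * u) (b * v) (c * w) = 0"
    and "thomson_form a b c (a * v * w) (b * w * u) (c * u * v) = 0"
proof -
  have *: "u * b * c * (v\<^sup>2 - w\<^sup>2) + v * c * a * (w\<^sup>2 - u\<^sup>2) + w * a * b * (u\<^sup>2 - v\<^sup>2) = 0"
    unfolding u_def v_def w_def by algebra
  have "thomson_form a b c (a * u) (b * v) (c * w) =
      a * b * c * (u * b * c * (v\<^sup>2 - w\<^sup>2) + v * c * a * (w\<^sup>2 - u\<^sup>2) + w * a * b * (u\<^sup>2 - v\<^sup>2))"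
    unfolding thomson_form_def by algebra
  then show "thomson_form a b c (a * u) (b * v) (c * w) = 0"
    unfolding * by simp
  have "thomson_form a b c (a * v * w) (b * w * u) (c * u * v) =
      - (a * b * c * u * v * w) * (u * b * c * (v\<^sup>2 - w\<^sup>2) + v * c * a * (w\<^sup>2 - u\<^sup>2) + w * a * b * (u\<^sup>2 - v\<^sup>2))"
    unfolding thomson_form_def by algebra
  then show "thomson_form a b c (a * v * w) (b * w * u) (c * u * v) = 0"
    unfolding * by simp
qed

lemma thomson_form_circumcenter:
  "thomson_form a b c (a\<^sup>2 * (b\<^sup>2 + c\<^sup>2 - a\<^sup>2)) (b\<^sup>2 * (c\<^sup>2 + a\<^sup>2 - b\<^sup>2)) (c\<^sup>2 * (a\<^sup>2 + b\<^sup>2 - c\<^sup>2)) = 0"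
  unfolding thomson_form_def by algebra

text \<open>\<open>thomson_cubic\<close> is a definite description, so its members become accessible
  only once it is identified with an explicit curve \<open>K\<close>. Existence asks for all fifteen
  points on \<open>K\<close>; uniqueness is drawn from ten of them.\<close>

lemma thomson_cubic_contains_defining_points:
  fixes A B C :: point
  assumes nc: "\<not> collinear {A, B, C}"
  defines "pts \<equiv> {A, B, C,
      midpoint B C, midpoint C A, midpoint A B,
      excenter A B C, excenter B C A, excenter C A B,
      incenter A B C, centroid A B C, circumcenter A B C, lemoine_point A B C,
      mittenpunkt A B C, isogonal_conjugate A B C (mittenpunkt A B C)}"
  shows "pts \<subseteq> thomson_cubic A B C"
proof -
  have nc': "\<not> collinear {B, C, A}" "\<not> collinear {C, A, B}"
    using nc by (simp_all add: insert_commute)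
  define a b c where abc: "a = dist B C" "b = dist C A" "c = dist A B"
  define u v w where uvw: "u = b + c - a" "v = c + a - b" "w = a + b - c"
  have pos: "a > 0" "b > 0" "c > 0"
    using not_collinear_imp_neq[OF nc] by (auto simp: abc)
  have uvw_pos: "u > 0" "v > 0" "w > 0"
    using dist_triangle_strict[OF nc] dist_triangle_strict[OF nc'(1)] dist_triangle_strict[OF nc'(2)]
    by (simp_all add: abc uvw)
  have less: "a < b + c" "b < c + a" "c < a + b"
    using uvw_pos by (simp_all add: uvw)
  define F where "F = (\<lambda>P. thomson_form a b c (coord A B C P) (coord B C A P) (coord C A B P))"
  define K where "K = {P. F P = 0}"
  have F_comb: "F (comb A B C x y z) = thomson_form a b c x y z" if "x + y + z = 1" for x y z
    using coord_comb[OF nc, of x y z] coord_comb[OF nc'(1), of y z x] coord_comb[OF nc'(2), of z x y] that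
    by (simp add: F_def comb_rotate(1)[of B C A] comb_rotate(2)[of C A B] add_ac)
  \<comment> \<open>By homogeneity the form can be evaluated at unnormalized coordinates, provided
    their sum is nonzero.\<close>
  have K_bary: "bary A B C x y z \<in> K" if "x + y + z \<noteq> 0" "thomson_form a b c x y z = 0" for x y z
    using F_comb[OF normalized_sum[OF that(1)]] that(2)
      thomson_form_homogeneous[of a b c "1 / (x + y + z)" x y z]
    by (simp add: K_def bary_def)
  have cubic: "cubic_curve K"
    unfolding K_def F_def using cubic_curve_thomson_form[OF nc] pos by simp
  have vertices: "A = bary A B C 1 0 0" "B = bary A B C 0 1 0" "C = bary A B C 0 0 1"
    by (simp_all add: bary_def comb_def)
  have midpoints: "midpoint B C = bary A B C 0 1 1" "midpoint C A = bary A B C 1 0 1"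
      "midpoint A B = bary A B C 1 1 0"
    by (simp_all add: bary_def comb_def midpoint_def scaleR_add_right add_ac)
  have bisectors: "incenter A B C = bary A B C a b c" "excenter A B C = bary A B C (- a) b c"
      "excenter B C A = bary A B C a (- b) c" "excenter C A B = bary A B C a b (- c)"
    using incenter_eq[OF nc] excenter_eq[OF nc] excenter_eq[OF nc'(1)] excenter_eq[OF nc'(2)]
      bary_rotate(1)[of B C A "- b" c a] bary_rotate(2)[of C A B "- c" a b]
    by (simp_all add: abc)
  have "pts \<subseteq> K"
  proof -
    have "P \<in> K" if "P \<in> {A, B, C}" for P
      using that K_bary[of 1 0 0] K_bary[of 0 1 0] K_bary[of 0 0 1] vertices
      by (auto simp: thomson_form_def)
    moreover have "P \<in> K" if "P \<in> {midpoint B C, midpoint C A, midpoint A B}" for P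
      using that K_bary[of 0 1 1] K_bary[of 1 0 1] K_bary[of 1 1 0] midpoints
      by (auto simp: thomson_form_def)
    moreover have "P \<in> K" if "P \<in> {excenter A B C, excenter B C A, excenter C A B, incenter A B C}" for P
      using that K_bary[of a b c] K_bary[of "- a" b c] K_bary[of a "- b" c] K_bary[of a b "- c"] bisectors pos less
      by (auto simp: thomson_form_def)
    moreover have "centroid A B C \<in> K"
      unfolding centroid_eq by (rule K_bary) (simp_all add: thomson_form_def)
    moreover have "circumcenter A B C \<in> K"
      unfolding circumcenter_eq_and_equidistant(1)[OF nc]
      using circumcenter_weight_pos[OF nc] thomson_form_circumcenter[of a b c]
      by (intro K_bary) (simp_all add: abc)
    moreover have "lemoine_point A B C \<in> K"
      unfolding lemoine_point_eq[OF nc, folded abc]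
    proof (rule K_bary)
      have "a\<^sup>2 + b\<^sup>2 + c\<^sup>2 > 0"
        using pos by (intro add_pos_pos) auto
      then show "a\<^sup>2 + b\<^sup>2 + c\<^sup>2 \<noteq> 0" by simp
      show "thomson_form a b c (a\<^sup>2) (b\<^sup>2) (c\<^sup>2) = 0"
        unfolding thomson_form_def by algebra
    qed
    moreover have "mittenpunkt A B C \<in> K"
      unfolding mittenpunkt_eq[OF nc, folded abc, folded uvw]
    proof (rule K_bary)
      have "a * u + b * v + c * w > 0"
        using pos uvw_pos by (intro add_pos_pos mult_pos_pos)
      then show "a * u + b * v + c * w \<noteq> 0" by simp
    qed (unfold uvw, rule thomson_form_mittenpunkt)
    moreover have "isogonal_conjugate A B C (mittenpunkt A B C) \<in> K"
      unfolding isogonal_conjugate_mittenpunkt_eq[OF nc, folded abc, folded uvw]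
    proof (rule K_bary)
      have "a * v * w + b * w * u + c * u * v > 0"
        using pos uvw_pos by (intro add_pos_pos mult_pos_pos)
      then show "a * v * w + b * w * u + c * u * v \<noteq> 0" by simp
    qed (unfold uvw, rule thomson_form_mittenpunkt)
    ultimately show ?thesis
      unfolding pts_def by blast
  qed
  moreover have "L = K" if L_cubic: "cubic_curve L" and "pts \<subseteq> L" for L
  proof -
    obtain e where lead: "\<exists>P v. third_difference (poly3 e) P v \<noteq> 0" and L: "L = {P. poly3 e P = 0}"
      using L_cubic unfolding cubic_curve_iff by blast
    obtain d where d: "\<And>x y z. x + y + z = 1 \<Longrightarrow> poly3 e (comb A B C x y z) = hom3 d x y z"
      using poly3_comb_eq_hom3 by meson
    have zero: "hom3 d x y z = 0" if "bary A B C x y z \<in> pts" "x + y + z \<noteq> 0" for x y z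
    proof -
      have "poly3 e (bary A B C x y z) = 0"
        using that(1) \<open>pts \<subseteq> L\<close> L by blast
      then have "hom3 d (1 / (x + y + z) * x) (1 / (x + y + z) * y) (1 / (x + y + z) * z) = 0"
        using d[OF normalized_sum[OF that(2)]] by (simp add: bary_def)
      then show ?thesis
        using that(2) unfolding hom3_homogeneous by simp
    qed
    have mem: "bary A B C 1 0 0 \<in> pts" "bary A B C 0 1 0 \<in> pts" "bary A B C 0 0 1 \<in> pts"
      "bary A B C 0 1 1 \<in> pts" "bary A B C 1 0 1 \<in> pts" "bary A B C 1 1 0 \<in> pts"
      "bary A B C a b c \<in> pts" "bary A B C (- a) b c \<in> pts" "bary A B C a (- b) c \<in> pts" "bary A B C a b (- c) \<in> pts"
      unfolding vertices[symmetric] midpoints[symmetric] bisectors[symmetric] pts_def by blast+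
    obtain k where k: "\<And>x y z. hom3 d x y z = k * thomson_form a b c x y z"
    proof -
      have "hom3 d 1 0 0 = 0" "hom3 d 0 1 0 = 0" "hom3 d 0 0 1 = 0"
          "hom3 d 0 1 1 = 0" "hom3 d 1 0 1 = 0" "hom3 d 1 1 0 = 0"
        by (rule zero, rule mem, simp)+
      moreover have "hom3 d a b c = 0" "hom3 d (- a) b c = 0" "hom3 d a (- b) c = 0" "hom3 d a b (- c) = 0"
        by (rule zero, rule mem, use pos less in linarith)+
      ultimately show ?thesis
        using hom3_eq_thomson_form[OF pos, of d] that by blast
    qed
    have e_F: "poly3 e P = k * F P" for P
    proof -
      obtain x y z where "x + y + z = 1" "P = comb A B C x y z"
        using comb_exhaust[OF nc] .
      then show ?thesis
        using d k F_comb by simp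
    qed
    \<comment> \<open>With \<open>k = 0\<close> the polynomial would vanish everywhere, and so would
      all its third differences, against degree exactly 3.\<close>
    then have "k \<noteq> 0"
      using lead by (auto simp: third_difference_def)
    then show "L = K"
      unfolding L K_def e_F by simp
  qed
  ultimately have "thomson_cubic A B C = K"
    unfolding thomson_cubic_def pts_def[symmetric] using cubic
    by (intro the_equality conjI) (assumption | elim conjE)+
  with \<open>pts \<subseteq> K\<close> show ?thesis
    by simp
qed

theorem theorem2:
  fixes H1 H2 H3 A B C :: "real^2"
  assumes "\<not> collinear {H1, H2, H3}"
    and "(A, B, C) = excentral_triangle H1 H2 H3"
  shows "orthic_triangle A B C = (H1, H2, H3) \<and>
         {A, B, C,
          H1, H2, H3,
          midpoint H2 H3, midpoint H3 H1, midpoint H1 H2,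
          orthocenter A B C,
          nine_point_center A B C,
          centroid H1 H2 H3,
          lemoine_point A B C,
          homothetic_center (orthic_triangle A B C) (tangential_triangle A B C)}
         \<subseteq> thomson_cubic H1 H2 H3"
proof -
  note nc = assms(1)
  have nc': "\<not> collinear {H2, H3, H1}" "\<not> collinear {H3, H1, H2}"
    using nc by (simp_all add: insert_commute)
  have ABC: "A = excenter H1 H2 H3" "B = excenter H2 H3 H1" "C = excenter H3 H1 H2"
    using assms(2) by (simp_all add: excentral_triangle_def)
  have orthic: "orthic_triangle A B C = (H1, H2, H3)"
    unfolding orthic_triangle_def ABC
    by (simp add: perp_foot_excenter[OF nc] perp_foot_excenter[OF nc'(1)] perp_foot_excenter[OF nc'(2)])
  have "orthocenter A B C = incenter H1 H2 H3"
    "nine_point_center A B C = circumcenter H1 H2 H3"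
    "lemoine_point A B C = mittenpunkt H1 H2 H3"
    "homothetic_center (orthic_triangle A B C) (tangential_triangle A B C) =
      isogonal_conjugate H1 H2 H3 (mittenpunkt H1 H2 H3)"
    unfolding orthic unfolding ABC
    using orthocenter_excenters[OF nc] nine_point_center_excenters[OF nc] homothetic_center_excenters[OF nc]
    by (simp_all add: mittenpunkt_def excentral_triangle_def)
  then show ?thesis
    using orthic thomson_cubic_contains_defining_points[OF nc] by (simp add: ABC)
qed

end
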